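(* Let $(E,\mathcal F,\mu)$ be a probability space and let $P$ be a Markov operator on $L^2(\mu)$ with $\mu P=\mu$ which is ergodic (i.e. $1$ is a simple eigenvalue of $P$). Let $P^*$ be the adjoint of $P$ on $L^2(\mu)$ and $\hat P=\frac12(P+P^* )$. Then the following statements are equivalent: (1) There is a constant $\theta\in[-1,1)$ such that the Poincar\'e inequality $$\mu(f^2)\le \frac{1}{1-\theta}\,\mu\big(f(f-Pf)\big)+\mu(f)^2,\qquad f\in L^2(\mu),$$ holds, i.e. $\hat P$ has a spectral gap ($1$ is an isolated point of the spectrum of $\hat P$). (2) $\|P\|_\tau<1$. (3) $\inf_{m\in\mathbb N}\|P^{2m-1}\|_\tau<1$. (4) $\inf_{m\in\mathbb N}\|\hat P^{m}\|_{tail}<1$.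
   Context: A Markov operator on $L^2(\mu)$ is a linear operator $P$ on $L^2(\mu)$ with $P1=1$ and $Pf\ge0$ whenever $f\ge0$; $\mu P=\mu$ means $\mu(Pf)=\mu(f)$ for all $f$. For a bounded operator $Q$ on $L^2(\mu)$ the tail norms are $$\|Q\|_\tau:=\lim_{R\to\infty}\sup_{\mu(f^2)\le1}\mu\big(f(Qf-R)^+\big),\qquad \|Q\|_{tail}:=\lim_{R\to\infty}\sup_{\mu(f^2)\le1}\mu\Big(\big((|Qf|-R)^+\big)^2\Big)^{1/2}.$$ *)

theory Defs
  imports "HOL-Probability.Probability"
begin

text \<open>Square-integrable real functions on a measure space (representatives of L^2(mu)).\<close>
definition L2 :: "'a measure \<Rightarrow> ('a \<Rightarrow> real) set" where
  "L2 M = {f. f \<in> borel_measurable M \<and> integrable M (\<lambda>x. (f x)\<^sup>2)}"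

definition markov_operator :: "'a measure \<Rightarrow> (('a \<Rightarrow> real) \<Rightarrow> ('a \<Rightarrow> real)) \<Rightarrow> bool" where
  "markov_operator M P \<longleftrightarrow>
     (\<forall>f\<in>L2 M. P f \<in> L2 M) \<and>
     (\<forall>f\<in>L2 M. \<forall>g\<in>L2 M. (AE x in M. f x = g x) \<longrightarrow> (AE x in M. P f x = P g x)) \<and>
     (\<forall>f\<in>L2 M. \<forall>g\<in>L2 M. \<forall>a b::real.
        AE x in M. P (\<lambda>y. a * f y + b * g y) x = a * P f x + b * P g x) \<and>
     (AE x in M. P (\<lambda>_. 1) x = 1) \<and>
     (\<forall>f\<in>L2 M. (AE x in M. f x \<ge> 0) \<longrightarrow> (AE x in M. P f x \<ge> 0))"

definition invariant_measure :: "'a measure \<Rightarrow> (('a \<Rightarrow> real) \<Rightarrow> ('a \<Rightarrow> real)) \<Rightarrow> bool" where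
  "invariant_measure M P \<longleftrightarrow> (\<forall>f\<in>L2 M. integral\<^sup>L M (P f) = integral\<^sup>L M f)"

definition ergodic_op :: "'a measure \<Rightarrow> (('a \<Rightarrow> real) \<Rightarrow> ('a \<Rightarrow> real)) \<Rightarrow> bool" where
  "ergodic_op M P \<longleftrightarrow>
     (\<forall>f\<in>L2 M. (AE x in M. P f x = f x) \<longrightarrow> (\<exists>c::real. AE x in M. f x = c))"

definition is_adjoint :: "'a measure \<Rightarrow> (('a \<Rightarrow> real) \<Rightarrow> ('a \<Rightarrow> real)) \<Rightarrow>
    (('a \<Rightarrow> real) \<Rightarrow> ('a \<Rightarrow> real)) \<Rightarrow> bool" where
  "is_adjoint M Q Q' \<longleftrightarrow> (\<forall>g\<in>L2 M. Q' g \<in> L2 M) \<and>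
     (\<forall>f\<in>L2 M. \<forall>g\<in>L2 M.
        integral\<^sup>L M (\<lambda>x. g x * Q f x) = integral\<^sup>L M (\<lambda>x. Q' g x * f x))"

definition pos_part :: "real \<Rightarrow> real" where
  "pos_part t = max t 0"

definition tau_norm :: "'a measure \<Rightarrow> (('a \<Rightarrow> real) \<Rightarrow> ('a \<Rightarrow> real)) \<Rightarrow> real" where
  "tau_norm M Q = Lim at_top (\<lambda>R::real.
     Sup {integral\<^sup>L M (\<lambda>x. f x * pos_part (Q f x - R)) | f.
            f \<in> L2 M \<and> integral\<^sup>L M (\<lambda>x. (f x)\<^sup>2) \<le> 1})"

definition tail_norm :: "'a measure \<Rightarrow> (('a \<Rightarrow> real) \<Rightarrow> ('a \<Rightarrow> real)) \<Rightarrow> real" where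
  "tail_norm M Q = Lim at_top (\<lambda>R::real.
     Sup {sqrt (integral\<^sup>L M (\<lambda>x. (pos_part (\<bar>Q f x\<bar> - R))\<^sup>2)) | f.
            f \<in> L2 M \<and> integral\<^sup>L M (\<lambda>x. (f x)\<^sup>2) \<le> 1})"

end

theory Submission
  imports Defs
begin

text \<open>Write \<open>\<E>(f) = \<mu>(f (f - P f))\<close>. If the Poincare inequality fails, there are \<open>f\<close> with
  \<open>\<mu>(f) = 0\<close>, \<open>\<mu>(f\<^sup>2) = 1\<close> and \<open>\<E>(f)\<close> arbitrarily small. From these one builds
  nonnegative unit functions with small \<open>\<E>\<close> and small mean; such functions force all tail norms
  of all powers to be at least one. If the squares \<open>f\<^sup>2\<close> are not uniformly integrable, one
  takes \<open>(|f| - K)\<^sup>+\<close>. Otherwise, after truncation, the \<open>f\<close> take values in \<open>[0, 1]\<close>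
  with variance bounded below; almost invariant bounded functions form an algebra by Jensen's
  inequality, and by ergodicity they are asymptotically independent of any fixed function, so
  products \<open>G\<close> of many of them have \<open>\<mu>(G)\<^sup>2 / \<mu>(G\<^sup>2)\<close> arbitrarily small.
  Conversely, the Poincare inequality bounds both tail norms directly.\<close>

section \<open>Square-integrable functions\<close>

text \<open>The obstacle is that failure of the Poincare inequality yields only almost invariance,
  whereas tail norms detect mass at large values. Ergodicity speaks about exact fixed points, so it
  enters by duality: mean-zero functions are L2 limits of coboundaries \<open>H - Pstar H\<close>,
  and an almost invariant \<open>g\<close> is nearly orthogonal to each of these. The resulting
  independence has a threshold depending on the fixed function, so the factors of a product must be
  chosen one after another. Products are controlled through the L1 distance of \<open>P g\<close>
  from \<open>g\<close>, which behaves linearly under multiplication of bounded functions, while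
  truncation is controlled by the quadratic form; on functions with values in [0, 1] each controls
  the other. A nonnegative unit function of mean at most \<open>e\<close> loses at most
  \<open>R * e\<close> when cut at \<open>R\<close>, and contractivity makes it almost invariant
  under any fixed power, so one construction settles every exponent. The form sees only the
  symmetric part of \<open>P\<close>, hence the same functions serve \<open>Phat\<close>.\<close>

definition L2_inner :: "'a measure \<Rightarrow> ('a \<Rightarrow> real) \<Rightarrow> ('a \<Rightarrow> real) \<Rightarrow> real" where
  "L2_inner M f g = integral\<^sup>L M (\<lambda>x. f x * g x)"

definition L2_norm :: "'a measure \<Rightarrow> ('a \<Rightarrow> real) \<Rightarrow> real" where
  "L2_norm M f = sqrt (L2_inner M f f)"

lemma L2_measurable [measurable_dest]: "f \<in> L2 M \<Longrightarrow> f \<in> borel_measurable M"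
  by (simp add: L2_def)

lemma L2_integrable_square: "f \<in> L2 M \<Longrightarrow> integrable M (\<lambda>x. (f x)\<^sup>2)"
  by (simp add: L2_def)

lemma L2_dominated:
  assumes f: "f \<in> L2 M" and [measurable]: "g \<in> borel_measurable M"
    and le: "AE x in M. \<bar>g x\<bar> \<le> \<bar>f x\<bar>"
  shows "g \<in> L2 M"
proof -
  have "integrable M (\<lambda>x. (g x)\<^sup>2)"
    by (rule Bochner_Integration.integrable_bound[OF L2_integrable_square[OF f]])
      (use le in \<open>auto simp: abs_le_square_iff\<close>)
  then show ?thesis by (simp add: L2_def)
qed

lemma L2_abs: "f \<in> L2 M \<Longrightarrow> (\<lambda>x. \<bar>f x\<bar>) \<in> L2 M"
  by (rule L2_dominated) (auto dest: L2_measurable)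

lemma L2_max_0: "f \<in> L2 M \<Longrightarrow> (\<lambda>x. max (f x) 0) \<in> L2 M"
  by (rule L2_dominated) (auto dest: L2_measurable)

lemma L2_mult_integrable:
  assumes "f \<in> L2 M" "g \<in> L2 M"
  shows "integrable M (\<lambda>x. f x * g x)"
proof (rule Bochner_Integration.integrable_bound)
  show "integrable M (\<lambda>x. (f x)\<^sup>2 + (g x)\<^sup>2)"
    using assms by (simp add: L2_integrable_square)
  show "(\<lambda>x. f x * g x) \<in> borel_measurable M"
    using assms[THEN L2_measurable] by measurable
  have "\<bar>a * b\<bar> \<le> a\<^sup>2 + b\<^sup>2" for a b :: real
  proof -
    have "2 * \<bar>a * b\<bar> \<le> a\<^sup>2 + b\<^sup>2"
      using sum_squares_bound[of "\<bar>a\<bar>" "\<bar>b\<bar>"] by (simp add: abs_mult mult.assoc)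
    then show ?thesis using abs_ge_zero[of "a*b"] by linarith
  qed
  then show "AE x in M. norm (f x * g x) \<le> norm ((f x)\<^sup>2 + (g x)\<^sup>2)" by simp
qed

lemma L2_cmult: "f \<in> L2 M \<Longrightarrow> (\<lambda>x. a * f x) \<in> L2 M"
  by (auto simp: L2_def power_mult_distrib)

lemma L2_add:
  assumes "f \<in> L2 M" "g \<in> L2 M"
  shows "(\<lambda>x. f x + g x) \<in> L2 M"
  using assms L2_mult_integrable[OF assms]
  by (auto simp: L2_def power2_sum mult.assoc intro!: borel_measurable_add Bochner_Integration.integrable_add)

lemma L2_diff:
  assumes "f \<in> L2 M" "g \<in> L2 M"
  shows "(\<lambda>x. f x - g x) \<in> L2 M"
  using L2_add[OF assms(1) L2_cmult[OF assms(2), of "-1"]] by simp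

lemma L2_lincomb:
  assumes "f \<in> L2 M" "g \<in> L2 M"
  shows "(\<lambda>x. a * f x + b * g x) \<in> L2 M"
  using assms by (intro L2_add L2_cmult)

lemma L2_uminus: "f \<in> L2 M \<Longrightarrow> (\<lambda>x. - f x) \<in> L2 M"
  using L2_cmult[of f M "-1"] by simp

lemma L2_inner_commute: "L2_inner M f g = L2_inner M g f"
  by (simp add: L2_inner_def mult.commute)

lemma L2_inner_self: "L2_inner M f f = integral\<^sup>L M (\<lambda>x. (f x)\<^sup>2)"
  by (simp add: L2_inner_def power2_eq_square)

lemma L2_inner_self_nonneg: "L2_inner M f f \<ge> 0"
  by (simp add: L2_inner_def)

lemma L2_norm_nonneg: "L2_norm M f \<ge> 0"
  by (simp add: L2_norm_def L2_inner_self_nonneg)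

lemma L2_norm_square: "(L2_norm M f)\<^sup>2 = L2_inner M f f"
  by (simp add: L2_norm_def L2_inner_self_nonneg)

lemma L2_inner_lincomb_left:
  assumes "f \<in> L2 M" "g \<in> L2 M" "h \<in> L2 M"
  shows "L2_inner M (\<lambda>x. a * f x + b * g x) h = a * L2_inner M f h + b * L2_inner M g h"
  using L2_mult_integrable[OF assms(1,3)] L2_mult_integrable[OF assms(2,3)]
  by (simp add: L2_inner_def distrib_right mult.assoc)

lemma L2_inner_lincomb_right:
  assumes "f \<in> L2 M" "g \<in> L2 M" "h \<in> L2 M"
  shows "L2_inner M h (\<lambda>x. a * f x + b * g x) = a * L2_inner M h f + b * L2_inner M h g"
  using L2_inner_lincomb_left[OF assms] by (simp add: L2_inner_commute)

lemma L2_inner_add_left: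
  assumes "f \<in> L2 M" "g \<in> L2 M" "h \<in> L2 M"
  shows "L2_inner M (\<lambda>x. f x + g x) h = L2_inner M f h + L2_inner M g h"
  using L2_inner_lincomb_left[OF assms, of 1 1] by simp

lemma L2_inner_add_right:
  assumes "f \<in> L2 M" "g \<in> L2 M" "h \<in> L2 M"
  shows "L2_inner M h (\<lambda>x. f x + g x) = L2_inner M h f + L2_inner M h g"
  using L2_inner_lincomb_right[OF assms, of 1 1] by simp

lemma L2_inner_diff_left:
  assumes "f \<in> L2 M" "g \<in> L2 M" "h \<in> L2 M"
  shows "L2_inner M (\<lambda>x. f x - g x) h = L2_inner M f h - L2_inner M g h"
  using L2_inner_lincomb_left[OF assms, of 1 "-1"] by simp

lemma L2_inner_diff_right:
  assumes "f \<in> L2 M" "g \<in> L2 M" "h \<in> L2 M"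
  shows "L2_inner M h (\<lambda>x. f x - g x) = L2_inner M h f - L2_inner M h g"
  using L2_inner_lincomb_right[OF assms, of 1 "-1"] by simp

lemma L2_inner_cmult_left: "L2_inner M (\<lambda>x. a * f x) g = a * L2_inner M f g"
  by (simp add: L2_inner_def mult.assoc)

lemma L2_inner_cmult_right: "L2_inner M f (\<lambda>x. a * g x) = a * L2_inner M f g"
  by (simp add: L2_inner_commute[of M f] L2_inner_cmult_left)

lemma L2_norm_cmult: "L2_norm M (\<lambda>x. a * f x) = \<bar>a\<bar> * L2_norm M f"
  by (simp add: L2_norm_def L2_inner_cmult_left L2_inner_cmult_right real_sqrt_mult
      flip: mult.assoc)

lemma L2_inner_mono:
  assumes "f \<in> L2 M" "g \<in> L2 M" "f' \<in> L2 M" "g' \<in> L2 M"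
    and "AE x in M. f x * g x \<le> f' x * g' x"
  shows "L2_inner M f g \<le> L2_inner M f' g'"
  unfolding L2_inner_def
  using assms by (intro integral_mono_AE L2_mult_integrable) auto

lemma L2_inner_nonneg:
  assumes "AE x in M. f x \<ge> 0" "AE x in M. g x \<ge> 0"
  shows "L2_inner M f g \<ge> 0"
  unfolding L2_inner_def using assms by (intro integral_nonneg_AE) auto

lemma L2_inner_cong_AE:
  assumes "f \<in> L2 M" "g \<in> L2 M" "f' \<in> L2 M" "g' \<in> L2 M"
    and "AE x in M. f x = f' x" "AE x in M. g x = g' x"
  shows "L2_inner M f g = L2_inner M f' g'"
  unfolding L2_inner_def
  using assms by (intro integral_cong_AE borel_measurable_times) (auto dest: L2_measurable)

text \<open>All combinations \<open>s * f + t * g\<close> have nonnegative square norm. If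
  \<open>g\<close> has positive norm, take s = <g,g> and t = -<f,g>; otherwise the expression with s
  = 1 is affine in \<open>t\<close>, which forces the inner product to vanish.\<close>

lemma L2_Cauchy_Schwarz_square:
  assumes f: "f \<in> L2 M" and g: "g \<in> L2 M"
  shows "(L2_inner M f g)\<^sup>2 \<le> L2_inner M f f * L2_inner M g g"
proof -
  let ?a = "L2_inner M f f" and ?b = "L2_inner M f g" and ?c = "L2_inner M g g"
  have q: "0 \<le> s\<^sup>2 * ?a + 2 * s * t * ?b + t\<^sup>2 * ?c" for s t
  proof -
    have "0 \<le> L2_inner M (\<lambda>x. s * f x + t * g x) (\<lambda>x. s * f x + t * g x)"
      by (rule L2_inner_self_nonneg)
    also have "\<dots> = s\<^sup>2 * ?a + 2 * s * t * ?b + t\<^sup>2 * ?c"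
      by (simp add: L2_inner_lincomb_left L2_inner_lincomb_right L2_lincomb f g
          L2_inner_commute[of M g f] power2_eq_square algebra_simps)
    finally show ?thesis .
  qed
  show ?thesis
  proof (cases "?c = 0")
    case True
    have "?b = 0"
    proof (rule ccontr)
      assume b: "?b \<noteq> 0"
      have "0 \<le> 1\<^sup>2 * ?a + 2 * 1 * (- (?a + 1) / (2 * ?b)) * ?b"
        using q[of 1 "- (?a + 1) / (2 * ?b)"] True by simp
      also have "\<dots> = -1" using b by (simp add: field_simps)
      finally show False by simp
    qed
    then show ?thesis using True by simp
  next
    case False
    then have c: "?c > 0" using L2_inner_self_nonneg[of M g] by linarith
    have "0 \<le> ?c\<^sup>2 * ?a + 2 * ?c * (- ?b) * ?b + (- ?b)\<^sup>2 * ?c" using q[of ?c "- ?b"] .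
    also have "\<dots> = ?c * (?a * ?c - ?b\<^sup>2)" by (simp add: power2_eq_square algebra_simps)
    finally show ?thesis using c by (simp add: zero_le_mult_iff)
  qed
qed

lemma L2_Cauchy_Schwarz:
  assumes "f \<in> L2 M" "g \<in> L2 M"
  shows "\<bar>L2_inner M f g\<bar> \<le> L2_norm M f * L2_norm M g"
  using real_sqrt_le_mono[OF L2_Cauchy_Schwarz_square[OF assms]]
  by (simp add: L2_norm_def real_sqrt_mult)

lemma L2_norm_triangle:
  assumes f: "f \<in> L2 M" and g: "g \<in> L2 M"
  shows "L2_norm M (\<lambda>x. f x + g x) \<le> L2_norm M f + L2_norm M g"
proof (rule power2_le_imp_le)
  have "(L2_norm M (\<lambda>x. f x + g x))\<^sup>2
      = (L2_norm M f)\<^sup>2 + 2 * L2_inner M f g + (L2_norm M g)\<^sup>2"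
    by (simp add: L2_norm_square L2_inner_add_left L2_inner_add_right L2_add f g
        L2_inner_commute[of M g f])
  also have "\<dots> \<le> (L2_norm M f + L2_norm M g)\<^sup>2"
    using L2_Cauchy_Schwarz[OF f g] by (simp add: power2_sum)
  finally show "(L2_norm M (\<lambda>x. f x + g x))\<^sup>2 \<le> (L2_norm M f + L2_norm M g)\<^sup>2" .
qed (simp add: L2_norm_nonneg)

lemma L2_norm_mono:
  assumes "f \<in> L2 M" "g \<in> L2 M" "AE x in M. \<bar>f x\<bar> \<le> \<bar>g x\<bar>"
  shows "L2_norm M f \<le> L2_norm M g"
  unfolding L2_norm_def
proof (intro real_sqrt_le_mono L2_inner_mono)
  show "AE x in M. f x * f x \<le> g x * g x"
    using assms(3) by (auto simp: abs_le_square_iff simp flip: power2_eq_square)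
qed (use assms in auto)

lemma L2_norm_cong_AE:
  assumes "f \<in> L2 M" "g \<in> L2 M" "AE x in M. f x = g x"
  shows "L2_norm M f = L2_norm M g"
  unfolding L2_norm_def by (simp add: L2_inner_cong_AE[OF assms(1,1,2,2,3,3)])

lemma L2_norm_eq_0_AE:
  assumes "f \<in> L2 M" "L2_norm M f = 0"
  shows "AE x in M. f x = 0"
proof -
  have "integral\<^sup>L M (\<lambda>x. (f x)\<^sup>2) = 0" using assms by (simp add: L2_norm_def L2_inner_self)
  then show ?thesis
    using integral_nonneg_eq_0_iff_AE[OF L2_integrable_square[OF assms(1)]] by simp
qed

text \<open>Norm bounds survive almost everywhere limits, membership in L2 included. This serves
  where norm convergence is not yet known: for completeness and for the contraction
  property.\<close>

lemma L2_Fatou: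
  assumes u: "\<And>n. u n \<in> L2 M" and [measurable]: "v \<in> borel_measurable M"
    and lim: "AE x in M. (\<lambda>n. u n x) \<longlonglongrightarrow> v x"
    and bound: "\<And>n. L2_inner M (u n) (u n) \<le> C"
  shows "v \<in> L2 M" "L2_inner M v v \<le> C"
proof -
  have C: "C \<ge> 0" using bound[of 0] L2_inner_self_nonneg[of M "u 0"] by linarith
  have um [measurable]: "\<And>n. u n \<in> borel_measurable M" using u L2_measurable by blast
  have b: "(\<integral>\<^sup>+x. ennreal ((u n x)\<^sup>2) \<partial>M) \<le> ennreal C" for n
    using bound[of n] L2_integrable_square[OF u[of n]]
    by (subst nn_integral_eq_integral) (auto simp: L2_inner_self intro: ennreal_leI)
  have "(\<integral>\<^sup>+x. ennreal ((v x)\<^sup>2) \<partial>M) = (\<integral>\<^sup>+x. liminf (\<lambda>n. ennreal ((u n x)\<^sup>2)) \<partial>M)"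
  proof (rule nn_integral_cong_AE)
    show "AE x in M. ennreal ((v x)\<^sup>2) = liminf (\<lambda>n. ennreal ((u n x)\<^sup>2))"
      using lim
    proof eventually_elim
      case (elim x)
      then have "(\<lambda>n. ennreal ((u n x)\<^sup>2)) \<longlonglongrightarrow> ennreal ((v x)\<^sup>2)"
        by (intro tendsto_ennrealI tendsto_power)
      then show ?case using lim_imp_Liminf[OF sequentially_bot] by metis
    qed
  qed
  also have "\<dots> \<le> liminf (\<lambda>n. \<integral>\<^sup>+x. ennreal ((u n x)\<^sup>2) \<partial>M)"
    by (rule nn_integral_liminf) measurable
  also have "\<dots> \<le> liminf (\<lambda>n. ennreal C)"
    using b by (intro Liminf_mono always_eventually) auto
  also have "\<dots> = ennreal C" by (simp add: Liminf_const)
  finally have le: "(\<integral>\<^sup>+x. ennreal ((v x)\<^sup>2) \<partial>M) \<le> ennreal C" .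
  then have int: "integrable M (\<lambda>x. (v x)\<^sup>2)"
    by (intro integrableI_bounded) (auto simp: le_less_trans)
  then show "v \<in> L2 M" by (simp add: L2_def)
  show "L2_inner M v v \<le> C"
    using le int C by (simp add: nn_integral_eq_integral L2_inner_self)
qed

section \<open>L2 over a probability space and its completeness\<close>

context prob_space
begin

lemma L2_bounded:
  assumes "f \<in> borel_measurable M" "AE x in M. \<bar>f x\<bar> \<le> K"
  shows "f \<in> L2 M"
proof -
  have "(\<lambda>_. K) \<in> L2 M" by (simp add: L2_def)
  then show ?thesis
    by (rule L2_dominated) (use assms in auto)
qed

lemma L2_const: "(\<lambda>_. c) \<in> L2 M"
  by (simp add: L2_def)

lemma L2_integrable:
  assumes "f \<in> L2 M"
  shows "integrable M f"
  using L2_mult_integrable[OF assms L2_const[of 1]] by simp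

lemma L2_inner_1: "L2_inner M f (\<lambda>_. 1) = expectation f"
  by (simp add: L2_inner_def)

lemma L2_norm_const: "L2_norm M (\<lambda>_. c) = \<bar>c\<bar>"
  by (simp add: L2_norm_def L2_inner_def prob_space)

lemma expectation_abs_le_L2_norm:
  assumes "f \<in> L2 M"
  shows "expectation (\<lambda>x. \<bar>f x\<bar>) \<le> L2_norm M f"
proof -
  have "expectation (\<lambda>x. \<bar>f x\<bar>) \<le> L2_norm M (\<lambda>x. \<bar>f x\<bar>)"
    using L2_Cauchy_Schwarz[OF L2_abs[OF assms] L2_const[of 1]]
    by (simp add: L2_inner_1 L2_norm_const)
  also have "\<dots> = L2_norm M f" by (simp add: L2_norm_def L2_inner_def)
  finally show ?thesis .
qed

text \<open>On a probability space L2-Cauchy implies L1-Cauchy, which supplies a subsequence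
  converging almost everywhere; Fatou applied to differences then returns convergence in L2
  norm.\<close>

lemma L2_complete:
  assumes u: "\<And>n. u n \<in> L2 M"
    and Cauchy: "\<And>e. e > 0 \<Longrightarrow> \<exists>N. \<forall>i\<ge>N. \<forall>j\<ge>N. L2_norm M (\<lambda>x. u i x - u j x) < e"
  obtains v where "v \<in> L2 M" "(\<lambda>n. L2_norm M (\<lambda>x. u n x - v x)) \<longlonglongrightarrow> 0"
proof -
  have um [measurable]: "\<And>n. u n \<in> borel_measurable M" using u L2_measurable by blast
  obtain r where r: "strict_mono r" and rC: "AE x in M. Cauchy (\<lambda>i. u (r i) x)"
  proof (rule cauchy_L1_AE_cauchy_subseq[of M u])
    show "integrable M (u n)" for n using u by (rule L2_integrable)
    fix e :: real assume "e > 0"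
    then obtain N where N: "\<forall>i\<ge>N. \<forall>j\<ge>N. L2_norm M (\<lambda>x. u i x - u j x) < e"
      using Cauchy by blast
    show "\<exists>N. \<forall>i\<ge>N. \<forall>j\<ge>N. expectation (\<lambda>x. norm (u i x - u j x)) < e"
    proof (intro exI[of _ N] allI impI)
      fix i j assume "i \<ge> N" "j \<ge> N"
      then show "expectation (\<lambda>x. norm (u i x - u j x)) < e"
        using N expectation_abs_le_L2_norm[OF L2_diff[OF u[of i] u[of j]]]
        by (auto simp: real_norm_def intro: le_less_trans)
    qed
  qed auto
  define v where "v x = lim (\<lambda>i. u (r i) x)" for x
  have vm [measurable]: "v \<in> borel_measurable M" unfolding v_def by measurable
  have lim: "AE x in M. (\<lambda>i. u (r i) x) \<longlonglongrightarrow> v x"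
    using rC by eventually_elim (auto simp: v_def Cauchy_convergent_iff convergent_LIMSEQ_iff)
  have close: "\<exists>N. \<forall>n\<ge>N. (\<lambda>x. u n x - v x) \<in> L2 M \<and> L2_norm M (\<lambda>x. u n x - v x) \<le> e"
    if "e > 0" for e
  proof -
    obtain N where N: "\<forall>i\<ge>N. \<forall>j\<ge>N. L2_norm M (\<lambda>x. u i x - u j x) < e"
      using Cauchy[OF \<open>e > 0\<close>] by blast
    have "(\<lambda>x. u n x - v x) \<in> L2 M \<and> L2_norm M (\<lambda>x. u n x - v x) \<le> e" if "n \<ge> N" for n
    proof -
      \<comment> \<open>The shift by \<open>N\<close> keeps every subsequence index at least
        \<open>N\<close>, so the Cauchy bound holds for all \<open>i\<close>.\<close>
      let ?w = "\<lambda>i x. u n x - u (r (i + N)) x"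
      have w: "?w i \<in> L2 M" for i by (intro L2_diff u)
      have wb: "L2_inner M (?w i) (?w i) \<le> e\<^sup>2" for i
      proof -
        have "N \<le> r (i + N)" using seq_suble[OF r, of "i + N"] by linarith
        then have "L2_norm M (?w i) \<le> e" using N \<open>n \<ge> N\<close> by (meson less_imp_le)
        then show ?thesis
          using power_mono[OF _ L2_norm_nonneg, of M "?w i" e 2] by (simp add: L2_norm_square)
      qed
      have wl: "AE x in M. (\<lambda>i. ?w i x) \<longlonglongrightarrow> u n x - v x"
        using lim by eventually_elim (intro tendsto_diff tendsto_const LIMSEQ_ignore_initial_segment)
      have 1: "(\<lambda>x. u n x - v x) \<in> L2 M" and 2: "L2_inner M (\<lambda>x. u n x - v x) (\<lambda>x. u n x - v x) \<le> e\<^sup>2"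
        using L2_Fatou[OF w _ wl wb] by auto
      from real_sqrt_le_mono[OF 2] \<open>e > 0\<close> 1 show ?thesis by (simp add: L2_norm_def)
    qed
    then show ?thesis by blast
  qed
  obtain N where "(\<lambda>x. u N x - v x) \<in> L2 M" using close[of 1] by auto
  from L2_diff[OF u[of N] this] have "v \<in> L2 M" by simp
  moreover have "(\<lambda>n. L2_norm M (\<lambda>x. u n x - v x)) \<longlonglongrightarrow> 0"
  proof (rule LIMSEQ_I)
    fix e :: real assume "e > 0"
    then show "\<exists>N. \<forall>n\<ge>N. norm (L2_norm M (\<lambda>x. u n x - v x) - 0) < e"
      using close[of "e/2"] by (auto simp: L2_norm_nonneg) (smt (verit) field_sum_of_halves)
  qed
  ultimately show ?thesis by (rule that)
qed

end

section \<open>Markov operators with an invariant probability measure\<close>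

locale markov_L2 = prob_space M for M :: "'a measure" +
  fixes P :: "('a \<Rightarrow> real) \<Rightarrow> ('a \<Rightarrow> real)"
  assumes markov: "markov_operator M P"
    and invariant: "invariant_measure M P"
begin

lemma P_L2: "f \<in> L2 M \<Longrightarrow> P f \<in> L2 M"
  using markov by (auto simp: markov_operator_def)

lemma P_cong_AE:
  "f \<in> L2 M \<Longrightarrow> g \<in> L2 M \<Longrightarrow> AE x in M. f x = g x \<Longrightarrow> AE x in M. P f x = P g x"
  using markov by (auto simp: markov_operator_def)

lemma P_lincomb:
  "f \<in> L2 M \<Longrightarrow> g \<in> L2 M \<Longrightarrow>
    AE x in M. P (\<lambda>y. a * f y + b * g y) x = a * P f x + b * P g x"
  using markov by (auto simp: markov_operator_def)

lemma P_nonneg: "f \<in> L2 M \<Longrightarrow> AE x in M. f x \<ge> 0 \<Longrightarrow> AE x in M. P f x \<ge> 0"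
  using markov by (auto simp: markov_operator_def)

lemma P_1: "AE x in M. P (\<lambda>_. 1) x = 1"
  using markov by (auto simp: markov_operator_def)

lemma expectation_P: "f \<in> L2 M \<Longrightarrow> expectation (P f) = expectation f"
  using invariant by (auto simp: invariant_measure_def)

lemma P_add:
  assumes "f \<in> L2 M" "g \<in> L2 M"
  shows "AE x in M. P (\<lambda>y. f y + g y) x = P f x + P g x"
  using P_lincomb[OF assms, of 1 1] by simp

lemma P_diff:
  assumes "f \<in> L2 M" "g \<in> L2 M"
  shows "AE x in M. P (\<lambda>y. f y - g y) x = P f x - P g x"
  using P_lincomb[OF assms, of 1 "-1"] by simp

lemma P_cmult:
  assumes "f \<in> L2 M"
  shows "AE x in M. P (\<lambda>y. a * f y) x = a * P f x"
  using P_lincomb[OF assms assms, of a 0] by simp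

lemma P_const: "AE x in M. P (\<lambda>_. c) x = c"
  using P_cmult[OF L2_const[of 1], of c] P_1 by auto

lemma P_add_const:
  assumes "f \<in> L2 M"
  shows "AE x in M. P (\<lambda>y. f y + c) x = P f x + c"
  using P_add[OF assms L2_const[of c]] P_const[of c] by auto

lemma P_mono:
  assumes "f \<in> L2 M" "g \<in> L2 M" "AE x in M. f x \<le> g x"
  shows "AE x in M. P f x \<le> P g x"
  using P_nonneg[OF L2_diff[OF assms(2,1)]] P_diff[OF assms(2,1)] assms(3) by auto

lemma P_uminus:
  assumes "f \<in> L2 M"
  shows "AE x in M. P (\<lambda>y. - f y) x = - P f x"
  using P_cmult[OF assms, of "-1"] by simp

lemma P_abs:
  assumes f: "f \<in> L2 M"
  shows "AE x in M. \<bar>P f x\<bar> \<le> P (\<lambda>y. \<bar>f y\<bar>) x"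
  using P_mono[OF f L2_abs[OF f]] P_mono[OF L2_uminus[OF f] L2_abs[OF f]] P_uminus[OF f]
  by auto

lemma P_bounded:
  assumes f: "f \<in> L2 M" and le: "AE x in M. \<bar>f x\<bar> \<le> K"
  shows "AE x in M. \<bar>P f x\<bar> \<le> K"
  using P_abs[OF f] P_mono[OF L2_abs[OF f] L2_const[of K] le] P_const[of K] by auto

text \<open>A square is the supremum of its tangents 2 * q * t - q^2, and positivity with
  \<open>P 1 = 1\<close> preserves each tangent inequality almost everywhere. Rational slopes
  suffice, so the exceptional sets have a null union.\<close>

lemma P_Jensen_square:
  assumes f: "f \<in> L2 M" and f2: "(\<lambda>x. (f x)\<^sup>2) \<in> L2 M"
  shows "AE x in M. (P f x)\<^sup>2 \<le> P (\<lambda>y. (f y)\<^sup>2) x"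
proof -
  have tangent: "AE x in M. 2 * q * P f x - q\<^sup>2 \<le> P (\<lambda>y. (f y)\<^sup>2) x" for q :: real
  proof -
    have "2 * q * t + (- (q\<^sup>2)) \<le> t\<^sup>2" for t :: real
      using zero_le_power2[of "t - q"] by (simp add: power2_eq_square algebra_simps)
    then have "AE x in M. P (\<lambda>y. 2 * q * f y + (- (q\<^sup>2))) x \<le> P (\<lambda>y. (f y)\<^sup>2) x"
      by (intro P_mono L2_add L2_cmult f L2_const f2) auto
    then show ?thesis
      using P_add_const[OF L2_cmult[OF f, of "2 * q"], of "- (q\<^sup>2)"] P_cmult[OF f, of "2 * q"]
      by auto
  qed
  have "AE x in M. \<forall>q\<in>\<rat>. 2 * q * P f x - q\<^sup>2 \<le> P (\<lambda>y. (f y)\<^sup>2) x"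
    using tangent by (subst AE_ball_countable) (auto intro: countable_rat)
  then show ?thesis
  proof eventually_elim
    case (elim x)
    show ?case
    proof (rule ccontr)
      assume "\<not> ?thesis"
      then have gap: "0 < (P f x)\<^sup>2 - P (\<lambda>y. (f y)\<^sup>2) x" (is "0 < ?d") by simp
      \<comment> \<open>For such \<open>q\<close> the tangent value is (P f x)^2 - (q - P f x)^2,
        which still exceeds \<open>P\<close> applied to the square.\<close>
      obtain q where q: "q \<in> \<rat>" "P f x < q" "q < P f x + sqrt ?d"
        using Rats_dense_in_real[of "P f x" "P f x + sqrt ?d"] gap by auto
      then have "(q - P f x)\<^sup>2 < (sqrt ?d)\<^sup>2" by (intro power_strict_mono) auto
      then have "(q - P f x)\<^sup>2 < ?d" using gap by simp
      with elim q(1) show False by (auto simp: power2_eq_square algebra_simps)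
    qed
  qed
qed

text \<open>Jensen needs the square to lie in L2, so it is applied to truncations. Continuity of
  \<open>P\<close> on L2 is not at hand, but positivity and invariance make \<open>P\<close> an L1
  contraction; a subsequence of the images therefore converges almost everywhere, and Fatou
  finishes.\<close>

lemma P_contraction:
  assumes f: "f \<in> L2 M"
  shows "L2_norm M (P f) \<le> L2_norm M f"
proof -
  have [measurable]: "f \<in> borel_measurable M" using f by (rule L2_measurable)
  define g where "g n x = max (- real n) (min (f x) (real n))" for n :: nat and x
  have gm [measurable]: "g n \<in> borel_measurable M" for n unfolding g_def by measurable
  have g_le: "\<bar>g n x\<bar> \<le> \<bar>f x\<bar>" and g_bd: "\<bar>g n x\<bar> \<le> real n" for n x
    by (auto simp: g_def)
  have g: "g n \<in> L2 M" for n by (rule L2_dominated[OF f]) (auto simp: g_le)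
  have g2: "(\<lambda>x. (g n x)\<^sup>2) \<in> L2 M" for n
    by (rule L2_bounded[where K = "(real n)\<^sup>2"])
      (use power_mono[OF g_bd[of n] abs_ge_zero, of _ 2] in auto)
  have bound: "L2_inner M (P (g n)) (P (g n)) \<le> L2_inner M f f" for n
  proof -
    have "L2_inner M (P (g n)) (P (g n)) \<le> expectation (P (\<lambda>x. (g n x)\<^sup>2))"
      unfolding L2_inner_self using P_Jensen_square[OF g g2]
      by (intro integral_mono_AE L2_integrable_square L2_integrable P_L2 g g2) auto
    also have "\<dots> = expectation (\<lambda>x. (g n x)\<^sup>2)" by (rule expectation_P[OF g2])
    also have "\<dots> \<le> L2_inner M f f"
      unfolding L2_inner_self using g_le
      by (intro integral_mono L2_integrable_square f g) (auto simp: abs_le_square_iff)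
    finally show ?thesis .
  qed
  have "(\<lambda>n. expectation (\<lambda>x. norm (P (g n) x - P f x))) \<longlonglongrightarrow> 0"
  proof (rule tendsto_sandwich[OF _ _ tendsto_const])
    have "(\<lambda>n. expectation (\<lambda>x. \<bar>g n x - f x\<bar>)) \<longlonglongrightarrow> expectation (\<lambda>x. 0)"
    proof (rule integral_dominated_convergence[where w = "\<lambda>x. 2 * \<bar>f x\<bar>"])
      show "AE x in M. (\<lambda>n. \<bar>g n x - f x\<bar>) \<longlonglongrightarrow> 0"
      proof (rule AE_I2)
        fix x
        have "eventually (\<lambda>n. \<bar>g n x - f x\<bar> = 0) sequentially"
          using eventually_ge_at_top[of "nat \<lceil>\<bar>f x\<bar>\<rceil>"]
          by eventually_elim (auto simp: g_def nat_ceiling_le_eq)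
        then show "(\<lambda>n. \<bar>g n x - f x\<bar>) \<longlonglongrightarrow> 0" by (rule tendsto_eventually)
      qed
      show "AE x in M. norm \<bar>g n x - f x\<bar> \<le> 2 * \<bar>f x\<bar>" for n
        using g_le[of n] by (auto intro!: AE_I2) (smt (verit))
    qed (use L2_integrable[OF f] in auto)
    then show "(\<lambda>n. expectation (\<lambda>x. \<bar>g n x - f x\<bar>)) \<longlonglongrightarrow> 0" by simp
    show "\<forall>\<^sub>F n in sequentially. expectation (\<lambda>x. norm (P (g n) x - P f x))
        \<le> expectation (\<lambda>x. \<bar>g n x - f x\<bar>)"
    proof (rule always_eventually, rule allI)
      fix n
      note d = L2_diff[OF g[of n] f]
      have "expectation (\<lambda>x. norm (P (g n) x - P f x)) \<le> expectation (P (\<lambda>x. \<bar>g n x - f x\<bar>))"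
        unfolding real_norm_def using P_abs[OF d] P_diff[OF g[of n] f]
        by (intro integral_mono_AE L2_integrable L2_abs L2_diff P_L2 f g) auto
      also have "\<dots> = expectation (\<lambda>x. \<bar>g n x - f x\<bar>)" by (rule expectation_P[OF L2_abs[OF d]])
      finally show "expectation (\<lambda>x. norm (P (g n) x - P f x)) \<le> expectation (\<lambda>x. \<bar>g n x - f x\<bar>)" .
    qed
  qed simp
  then obtain r :: "nat \<Rightarrow> nat" where "AE x in M. (\<lambda>n. P (g (r n)) x - P f x) \<longlonglongrightarrow> 0"
    using tendsto_L1_AE_subseq[of M "\<lambda>n x. P (g n) x - P f x"] L2_integrable[OF L2_diff[OF P_L2[OF g] P_L2[OF f]]]
    by auto
  then have "AE x in M. (\<lambda>n. P (g (r n)) x) \<longlonglongrightarrow> P f x"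
    by (simp add: LIM_zero_iff)
  then have "L2_inner M (P f) (P f) \<le> L2_inner M f f"
    using L2_Fatou(2)[OF P_L2[OF g] L2_measurable[OF P_L2[OF f]] _ bound] by blast
  then show ?thesis by (simp add: L2_norm_def)
qed

lemma P_contraction_inner:
  assumes "f \<in> L2 M"
  shows "L2_inner M (P f) (P f) \<le> L2_inner M f f"
  using P_contraction[OF assms] by (simp add: L2_norm_def)

lemma P_inner_le:
  assumes "f \<in> L2 M"
  shows "L2_inner M f (P f) \<le> L2_inner M f f"
proof -
  have "L2_inner M f (P f) \<le> L2_norm M f * L2_norm M (P f)"
    using L2_Cauchy_Schwarz[OF assms P_L2[OF assms]] by simp
  also have "\<dots> \<le> L2_norm M f * L2_norm M f"
    by (intro mult_left_mono P_contraction assms L2_norm_nonneg)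
  also have "\<dots> = L2_inner M f f" by (simp add: L2_norm_square flip: power2_eq_square)
  finally show ?thesis .
qed

section \<open>Dirichlet form and L1 defect of invariance\<close>

definition form :: "('a \<Rightarrow> real) \<Rightarrow> real" where
  "form f = L2_inner M f f - L2_inner M f (P f)"

text \<open>Measured in L1 because Jensen gives a one-sided pointwise bound whose integral is
  computed by invariance; this makes almost invariance stable under squares and products.\<close>

definition defect :: "('a \<Rightarrow> real) \<Rightarrow> real" where
  "defect f = expectation (\<lambda>x. \<bar>P f x - f x\<bar>)"

lemma form_nonneg: "f \<in> L2 M \<Longrightarrow> form f \<ge> 0"
  using P_inner_le by (simp add: form_def)

lemma form_eq_expectation:
  assumes "f \<in> L2 M"
  shows "expectation (\<lambda>x. f x * (f x - P f x)) = form f"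
  using L2_inner_diff_right[OF assms P_L2[OF assms] assms]
  by (simp add: form_def L2_inner_def)

text \<open>Expanding the square leaves only the square norm of \<open>P f\<close> to be estimated,
  and contraction bounds it by that of \<open>f\<close>.\<close>

lemma norm_P_diff_le_form:
  assumes f: "f \<in> L2 M"
  shows "(L2_norm M (\<lambda>x. P f x - f x))\<^sup>2 \<le> 2 * form f"
proof -
  have "(L2_norm M (\<lambda>x. P f x - f x))\<^sup>2
      = L2_inner M (P f) (P f) - 2 * L2_inner M f (P f) + L2_inner M f f"
    by (simp add: L2_norm_square L2_inner_diff_left L2_inner_diff_right L2_diff P_L2 f
        L2_inner_commute[of M "P f" f])
  then show ?thesis using P_contraction_inner[OF f] by (simp add: form_def)
qed

lemma form_abs:
  assumes f: "f \<in> L2 M"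
  shows "form (\<lambda>x. \<bar>f x\<bar>) \<le> form f"
proof -
  have "L2_inner M f (P f) \<le> L2_inner M (\<lambda>x. \<bar>f x\<bar>) (P (\<lambda>x. \<bar>f x\<bar>))"
  proof (rule L2_inner_mono)
    show "AE x in M. f x * P f x \<le> \<bar>f x\<bar> * P (\<lambda>x. \<bar>f x\<bar>) x"
      using P_abs[OF f]
    proof eventually_elim
      case (elim x)
      have "f x * P f x \<le> \<bar>f x\<bar> * \<bar>P f x\<bar>" by (metis abs_ge_self abs_mult)
      also have "\<dots> \<le> \<bar>f x\<bar> * P (\<lambda>x. \<bar>f x\<bar>) x" by (intro mult_left_mono elim) auto
      finally show ?case .
    qed
  qed (intro P_L2 L2_abs f)+
  moreover have "L2_inner M (\<lambda>x. \<bar>f x\<bar>) (\<lambda>x. \<bar>f x\<bar>) = L2_inner M f f" by (simp add: L2_inner_def)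
  ultimately show ?thesis by (simp add: form_def)
qed

lemma form_cmult:
  assumes f: "f \<in> L2 M"
  shows "form (\<lambda>x. a * f x) = a\<^sup>2 * form f"
proof -
  have eq: "L2_inner M (\<lambda>x. a * f x) (P (\<lambda>x. a * f x)) = L2_inner M (\<lambda>x. a * f x) (\<lambda>x. a * P f x)"
    by (intro L2_inner_cong_AE P_L2 L2_cmult f P_cmult) auto
  show ?thesis
    unfolding form_def eq by (simp add: L2_inner_cmult_left L2_inner_cmult_right power2_eq_square algebra_simps)
qed

lemma form_lincomb:
  assumes f: "f \<in> L2 M" and g: "g \<in> L2 M"
  shows "form (\<lambda>x. a * f x + b * g x) = a\<^sup>2 * form f + b\<^sup>2 * form g
    + a * b * (2 * L2_inner M f g - L2_inner M f (P g) - L2_inner M g (P f))"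
proof -
  have "L2_inner M (\<lambda>x. a * f x + b * g x) (P (\<lambda>x. a * f x + b * g x))
      = L2_inner M (\<lambda>x. a * f x + b * g x) (\<lambda>x. a * P f x + b * P g x)"
    by (intro L2_inner_cong_AE P_L2 L2_lincomb f g P_lincomb) auto
  then show ?thesis
    by (simp add: form_def L2_inner_lincomb_left L2_inner_lincomb_right L2_lincomb P_L2 f g
        L2_inner_commute[of M g f] power2_eq_square algebra_simps)
qed

text \<open>Parallelogram law for a quadratic form: the cross terms for \<open>f + g\<close> and
  \<open>f - g\<close> cancel even when \<open>P\<close> is not symmetric, and the form of the
  difference is nonnegative.\<close>

lemma form_add_le:
  assumes f: "f \<in> L2 M" and g: "g \<in> L2 M"
  shows "form (\<lambda>x. f x + g x) \<le> 2 * form f + 2 * form g"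
  using form_lincomb[OF f g, of 1 1] form_lincomb[OF f g, of 1 "-1"]
    form_nonneg[OF L2_lincomb[OF f g, of 1 "-1"]] by simp

lemma form_add_const:
  assumes f: "f \<in> L2 M"
  shows "form (\<lambda>x. f x + c) = form f"
proof -
  have c: "L2_inner M g (P (\<lambda>_. 1)) = expectation g" if "g \<in> L2 M" for g
    using L2_inner_cong_AE[OF that P_L2[OF L2_const] that L2_const _ P_1] by (simp add: L2_inner_1)
  have "form (\<lambda>_. 1) = 0"
    by (simp add: form_def c L2_const L2_inner_1)
  then show ?thesis
    using form_lincomb[OF f L2_const, of 1 c 1] f
    by (simp add: c L2_inner_1 L2_inner_commute[of M "\<lambda>_. 1"] expectation_P)
qed

text \<open>With max f 0 = (f + |f|) / 2, the factor 2 lost in \<open>form_add_le\<close> is offset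
  by the squares of the coefficients 1/2. The resulting constant is exactly 1, so truncations can be
  iterated at no cost.\<close>

lemma form_max_0:
  assumes f: "f \<in> L2 M"
  shows "form (\<lambda>x. max (f x) 0) \<le> form f"
proof -
  have eq: "(\<lambda>x. max (f x) 0) = (\<lambda>x. (1/2) * f x + (1/2) * \<bar>f x\<bar>)" by auto
  have "form (\<lambda>x. (1/2) * f x + (1/2) * \<bar>f x\<bar>)
      \<le> 2 * form (\<lambda>x. (1/2) * f x) + 2 * form (\<lambda>x. (1/2) * \<bar>f x\<bar>)"
    by (intro form_add_le L2_cmult L2_abs f)
  also have "\<dots> = form f / 2 + form (\<lambda>x. \<bar>f x\<bar>) / 2"
    by (subst (1 2) form_cmult) (auto intro: f L2_abs simp: power2_eq_square)
  also have "\<dots> \<le> form f" using form_abs[OF f] by simp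
  finally show ?thesis by (simp only: eq)
qed

lemma form_max_const:
  assumes f: "f \<in> L2 M"
  shows "form (\<lambda>x. max (f x) c) \<le> form f"
proof -
  have d: "(\<lambda>x. f x + (- c)) \<in> L2 M" by (intro L2_add f L2_const)
  have "(\<lambda>x. max (f x) c) = (\<lambda>x. max (f x + (- c)) 0 + c)" by auto
  then show ?thesis
    using form_max_0[OF d] form_add_const[OF f, of "- c"] form_add_const[OF L2_max_0[OF d], of c]
    by simp
qed

lemma form_min_const:
  assumes f: "f \<in> L2 M"
  shows "form (\<lambda>x. min (f x) c) \<le> form f"
proof -
  have m: "(\<lambda>x. max (- f x) (- c)) \<in> L2 M"
  proof -
    have "(\<lambda>x. max (- f x + c) 0 + (- c)) \<in> L2 M"
      by (intro L2_add L2_max_0 L2_uminus f L2_const)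
    also have "(\<lambda>x. max (- f x + c) 0 + (- c)) = (\<lambda>x. max (- f x) (- c))" by auto
    finally show ?thesis .
  qed
  have eq: "(\<lambda>x. min (f x) c) = (\<lambda>x. (-1) * max (- f x) (- c))" by auto
  have "form (\<lambda>x. min (f x) c) = form (\<lambda>x. max (- f x) (- c))"
    unfolding eq using form_cmult[OF m, of "-1"] by simp
  also have "\<dots> \<le> form (\<lambda>x. - f x)" by (rule form_max_const[OF L2_uminus[OF f]])
  also have "\<dots> = form f" using form_cmult[OF f, of "-1"] by simp
  finally show ?thesis .
qed

lemma defect_le_form:
  assumes f: "f \<in> L2 M"
  shows "defect f \<le> sqrt (2 * form f)"
  using expectation_abs_le_L2_norm[OF L2_diff[OF P_L2[OF f] f]]
    real_le_rsqrt[OF norm_P_diff_le_form[OF f]]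
  by (simp add: defect_def)

lemma defect_add_le:
  assumes f: "f \<in> L2 M" and g: "g \<in> L2 M"
  shows "defect (\<lambda>x. f x + g x) \<le> defect f + defect g"
proof -
  have i: "integrable M (\<lambda>x. \<bar>P h x - h x\<bar>)" if "h \<in> L2 M" for h
    by (intro L2_integrable L2_abs L2_diff P_L2 that)
  have "defect (\<lambda>x. f x + g x) \<le> expectation (\<lambda>x. \<bar>P f x - f x\<bar> + \<bar>P g x - g x\<bar>)"
    unfolding defect_def using P_add[OF f g]
    by (intro integral_mono_AE Bochner_Integration.integrable_add i L2_add f g) auto
  also have "\<dots> = defect f + defect g"
    unfolding defect_def by (intro Bochner_Integration.integral_add i f g)
  finally show ?thesis .
qed

lemma defect_cmult:
  assumes f: "f \<in> L2 M"
  shows "defect (\<lambda>x. a * f x) = \<bar>a\<bar> * defect f"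
proof -
  have "defect (\<lambda>x. a * f x) = expectation (\<lambda>x. \<bar>a\<bar> * \<bar>P f x - f x\<bar>)"
    unfolding defect_def
  proof (rule integral_cong_AE)
    show "AE x in M. \<bar>P (\<lambda>x. a * f x) x - a * f x\<bar> = \<bar>a\<bar> * \<bar>P f x - f x\<bar>"
      using P_cmult[OF f, of a] by eventually_elim (simp flip: abs_mult add: right_diff_distrib)
    show "(\<lambda>x. \<bar>P (\<lambda>x. a * f x) x - a * f x\<bar>) \<in> borel_measurable M"
      by (intro L2_measurable L2_abs L2_diff P_L2 L2_cmult f)
    show "(\<lambda>x. \<bar>a\<bar> * \<bar>P f x - f x\<bar>) \<in> borel_measurable M"
      by (intro L2_measurable L2_cmult L2_abs L2_diff P_L2 f)
  qed
  then show ?thesis by (simp add: defect_def)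
qed

text \<open>Split P(f^2) - f^2 into the Jensen gap P(f^2) - (P f)^2, which is nonnegative, and (P
  f)^2 - f^2, at most 2 * K * |P f - f| in absolute value. A real number whose negative part is at
  most \<open>e\<close> has absolute value at most itself plus 2 * e, and P(f^2) - f^2 integrates to
  zero by invariance.\<close>

lemma defect_square_le:
  assumes [measurable]: "f \<in> borel_measurable M" and bd: "\<And>x. \<bar>f x\<bar> \<le> K"
  shows "defect (\<lambda>x. (f x)\<^sup>2) \<le> 4 * K * defect f"
proof -
  have f: "f \<in> L2 M" by (rule L2_bounded[where K = K]) (auto simp: bd)
  have f2: "(\<lambda>x. (f x)\<^sup>2) \<in> L2 M"
    by (rule L2_bounded[where K = "K\<^sup>2"]) (use power_mono[OF bd abs_ge_zero, of _ 2] in auto)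
  note Pf = P_L2[OF f] and Pf2 = P_L2[OF f2]
  have d: "integrable M (\<lambda>x. \<bar>P f x - f x\<bar>)" by (intro L2_integrable L2_abs L2_diff Pf f)
  have "AE x in M. \<bar>P (\<lambda>x. (f x)\<^sup>2) x - (f x)\<^sup>2\<bar>
      \<le> P (\<lambda>x. (f x)\<^sup>2) x - (f x)\<^sup>2 + 4 * K * \<bar>P f x - f x\<bar>"
    using P_Jensen_square[OF f f2] P_bounded[OF f AE_I2[OF bd]]
  proof eventually_elim
    case (elim x)
    have "\<bar>(P f x)\<^sup>2 - (f x)\<^sup>2\<bar> = \<bar>P f x + f x\<bar> * \<bar>P f x - f x\<bar>"
      by (simp add: power2_eq_square algebra_simps flip: abs_mult)
    also have "\<dots> \<le> (2 * K) * \<bar>P f x - f x\<bar>"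
      using elim bd[of x] by (intro mult_right_mono) auto
    finally show ?case using elim(1) by (auto simp: abs_if split: if_splits)
  qed
  then have "defect (\<lambda>x. (f x)\<^sup>2) \<le> expectation (\<lambda>x. P (\<lambda>x. (f x)\<^sup>2) x - (f x)\<^sup>2 + 4 * K * \<bar>P f x - f x\<bar>)"
    unfolding defect_def
    by (intro integral_mono_AE L2_integrable L2_abs L2_diff L2_add L2_cmult Pf Pf2 f f2) auto
  also have "\<dots> = expectation (P (\<lambda>x. (f x)\<^sup>2)) - expectation (\<lambda>x. (f x)\<^sup>2) + 4 * K * defect f"
    using L2_integrable[OF Pf2] L2_integrable[OF f2] d by (simp add: defect_def)
  also have "\<dots> = 4 * K * defect f" by (simp add: expectation_P[OF f2])
  finally show ?thesis .
qed

text \<open>Polarisation: f * g = ((f + g)^2 - (f - g)^2) / 4. Sum and difference are bounded by 2,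
  so each square costs a factor 8, and 4 = (8 + 8) / 4.\<close>

lemma defect_mult_le:
  assumes [measurable]: "f \<in> borel_measurable M" "g \<in> borel_measurable M"
    and f1: "\<And>x. \<bar>f x\<bar> \<le> 1" and g1: "\<And>x. \<bar>g x\<bar> \<le> 1"
  shows "defect (\<lambda>x. f x * g x) \<le> 4 * (defect f + defect g)"
proof -
  have f: "f \<in> L2 M" by (rule L2_bounded[where K = 1]) (auto simp: f1)
  have g: "g \<in> L2 M" by (rule L2_bounded[where K = 1]) (auto simp: g1)
  let ?s = "\<lambda>x. (f x + g x)\<^sup>2" and ?d = "\<lambda>x. (f x + (-1) * g x)\<^sup>2"
  have sb: "\<bar>f x + g x\<bar> \<le> 2" and db: "\<bar>f x + (-1) * g x\<bar> \<le> 2" for x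
    using f1[of x] g1[of x] by auto
  have s2: "?s \<in> L2 M"
    by (rule L2_bounded[where K = "2\<^sup>2"]) (use power_mono[OF sb abs_ge_zero, of _ 2] in auto)
  have d2: "?d \<in> L2 M"
    by (rule L2_bounded[where K = "2\<^sup>2"]) (use power_mono[OF db abs_ge_zero, of _ 2] in auto)
  have eq: "(\<lambda>x. f x * g x) = (\<lambda>x. (1/4) * ?s x + (- (1/4)) * ?d x)"
    by (auto simp: power2_eq_square algebra_simps)
  have "defect (\<lambda>x. f x * g x) \<le> (1/4) * defect ?s + (1/4) * defect ?d"
    unfolding eq
    using defect_add_le[OF L2_cmult[OF s2, of "1/4"] L2_cmult[OF d2, of "- (1/4)"]]
      defect_cmult[OF s2, of "1/4"] defect_cmult[OF d2, of "-(1/4)"] by simp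
  moreover have "defect ?s \<le> 8 * (defect f + defect g)"
    using defect_square_le[of "\<lambda>x. f x + g x" 2] defect_add_le[OF f g] sb by simp
  moreover have "defect ?d \<le> 8 * (defect f + defect g)"
    using defect_square_le[of "\<lambda>x. f x + (-1) * g x" 2] db
      defect_add_le[OF f L2_cmult[OF g, of "-1"]] defect_cmult[OF g, of "-1"] by simp
  ultimately show ?thesis by linarith
qed

lemma form_le_defect:
  assumes [measurable]: "f \<in> borel_measurable M" and f1: "\<And>x. \<bar>f x\<bar> \<le> 1"
  shows "form f \<le> defect f"
proof -
  have f: "f \<in> L2 M" by (rule L2_bounded[where K = 1]) (auto simp: f1)
  have "expectation (\<lambda>x. f x * (f x - P f x)) \<le> expectation (\<lambda>x. \<bar>P f x - f x\<bar>)"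
  proof (rule integral_mono)
    fix x
    have "f x * (f x - P f x) \<le> \<bar>f x\<bar> * \<bar>f x - P f x\<bar>" by (metis abs_ge_self abs_mult)
    also have "\<dots> \<le> 1 * \<bar>P f x - f x\<bar>"
      using f1[of x] by (subst abs_minus_commute) (intro mult_right_mono, auto)
    finally show "f x * (f x - P f x) \<le> \<bar>P f x - f x\<bar>" by simp
  qed (intro L2_mult_integrable L2_integrable L2_abs L2_diff P_L2 f)+
  then show ?thesis by (simp add: form_eq_expectation[OF f] defect_def)
qed

text \<open>The way back from L1 to L2, with the form as intermediary; this is what lets a small
  defect be paired with an arbitrary L2 function.\<close>

lemma norm_P_diff_le_defect:
  assumes [measurable]: "g \<in> borel_measurable M" and g01: "\<And>x. 0 \<le> g x \<and> g x \<le> 1"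
  shows "(L2_norm M (\<lambda>x. P g x - g x))\<^sup>2 \<le> 2 * defect g"
  using norm_P_diff_le_form[OF L2_bounded[of g 1]] form_le_defect[of g] g01
  by (smt (verit) AE_I2 assms(1))

end

section \<open>Ergodicity and decorrelation\<close>

lemma L2_eqI_AE:
  assumes u: "u \<in> L2 M" and v: "v \<in> L2 M"
    and eq: "\<And>h. h \<in> L2 M \<Longrightarrow> L2_inner M u h = L2_inner M v h"
  shows "AE x in M. u x = v x"
proof -
  note d = L2_diff[OF u v]
  have "L2_norm M (\<lambda>x. u x - v x) = 0"
    by (simp add: L2_norm_def L2_inner_diff_left[OF u v d] eq[OF d])
  from L2_norm_eq_0_AE[OF d this] show ?thesis by simp
qed

lemma (in prob_space) L2_norm_centered:
  assumes f: "f \<in> L2 M"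
  shows "(L2_norm M (\<lambda>x. f x - expectation f))\<^sup>2 = L2_inner M f f - (expectation f)\<^sup>2"
proof -
  let ?m = "expectation f"
  have "(L2_norm M (\<lambda>x. f x - ?m))\<^sup>2 = L2_inner M (\<lambda>x. 1 * f x + (- ?m) * 1) (\<lambda>x. 1 * f x + (- ?m) * 1)"
    by (simp add: L2_norm_square)
  also have "\<dots> = L2_inner M f f - ?m\<^sup>2"
    unfolding L2_inner_lincomb_left[OF f L2_const L2_lincomb[OF f L2_const]]
      L2_inner_lincomb_right[OF f L2_const f] L2_inner_lincomb_right[OF f L2_const L2_const]
      L2_inner_commute[of M "\<lambda>_. 1" f] L2_inner_1
    by (simp add: prob_space power2_eq_square algebra_simps)
  finally show ?thesis .
qed

lemma is_adjoint_inner: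
  assumes "is_adjoint M P Q" "f \<in> L2 M" "g \<in> L2 M"
  shows "L2_inner M g (P f) = L2_inner M (Q g) f"
  using assms by (auto simp: is_adjoint_def L2_inner_def)

lemma is_adjoint_L2: "is_adjoint M P Q \<Longrightarrow> g \<in> L2 M \<Longrightarrow> Q g \<in> L2 M"
  by (auto simp: is_adjoint_def)

text \<open>The adjoint is given only through its pairings, so linearity has to be read off from
  inner products and holds almost everywhere.\<close>

lemma is_adjoint_lincomb:
  assumes adj: "is_adjoint M P Q" and P: "\<And>f. f \<in> L2 M \<Longrightarrow> P f \<in> L2 M"
    and f: "f \<in> L2 M" and g: "g \<in> L2 M"
  shows "AE x in M. Q (\<lambda>y. a * f y + b * g y) x = a * Q f x + b * Q g x"
proof (rule L2_eqI_AE)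
  note Q = is_adjoint_L2[OF adj]
  show "Q (\<lambda>y. a * f y + b * g y) \<in> L2 M" by (intro Q L2_lincomb f g)
  show "(\<lambda>x. a * Q f x + b * Q g x) \<in> L2 M" by (intro Q L2_lincomb f g)
  fix h assume h: "h \<in> L2 M"
  show "L2_inner M (Q (\<lambda>y. a * f y + b * g y)) h = L2_inner M (\<lambda>x. a * Q f x + b * Q g x) h"
    by (simp add: is_adjoint_inner[OF adj, symmetric] L2_inner_lincomb_left L2_lincomb f g h P Q)
qed

locale ergodic_markov_L2 = markov_L2 +
  fixes Pstar :: "('a \<Rightarrow> real) \<Rightarrow> ('a \<Rightarrow> real)"
  assumes ergodic: "ergodic_op M P"
    and adjoint: "is_adjoint M P Pstar"
begin

lemmas Pstar_L2 = is_adjoint_L2[OF adjoint]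
lemmas Pstar_inner = is_adjoint_inner[OF adjoint]

lemma Pstar_lincomb:
  assumes "f \<in> L2 M" "g \<in> L2 M"
  shows "AE x in M. Pstar (\<lambda>y. a * f y + b * g y) x = a * Pstar f x + b * Pstar g x"
  by (rule is_adjoint_lincomb[OF adjoint]) (use assms P_L2 in auto)

lemma expectation_Pstar:
  assumes "g \<in> L2 M"
  shows "expectation (Pstar g) = expectation g"
proof -
  have "expectation (Pstar g) = L2_inner M g (P (\<lambda>_. 1))"
    using Pstar_inner[OF L2_const[of 1] assms] by (simp add: L2_inner_1)
  also have "\<dots> = L2_inner M g (\<lambda>_. 1)"
    by (intro L2_inner_cong_AE P_L2 L2_const assms P_1) auto
  finally show ?thesis by (simp add: L2_inner_1)
qed

text \<open>The element of minimal norm in the closure of the coset of coboundaries is orthogonal to all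
  coboundaries, hence fixed by the operator, hence constant by ergodicity.\<close>

lemma coboundaries_dense:
  assumes F: "F \<in> L2 M" and EF: "expectation F = 0" and "\<kappa> > 0"
  obtains H where "H \<in> L2 M" "L2_norm M (\<lambda>x. F x - (H x - Pstar H x)) \<le> \<kappa>"
proof -
  \<comment> \<open>The coset of \<open>F\<close> modulo the range of \<open>I - Pstar\<close>,
    written with almost everywhere equality so that it is closed under midpoints and under adding
    coboundaries.\<close>
  define W where "W = {u \<in> L2 M. \<exists>H\<in>L2 M. AE x in M. u x = F x - (H x - Pstar H x)}"
  have W_L2: "u \<in> L2 M" if "u \<in> W" for u using that by (simp add: W_def)
  have W_mid: "(\<lambda>x. (1/2) * u x + (1/2) * u' x) \<in> W" if "u \<in> W" "u' \<in> W" for u u'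
  proof -
    from that obtain H H' where H: "H \<in> L2 M" "AE x in M. u x = F x - (H x - Pstar H x)"
      and H': "H' \<in> L2 M" "AE x in M. u' x = F x - (H' x - Pstar H' x)" by (auto simp: W_def)
    have "AE x in M. (1/2) * u x + (1/2) * u' x = F x - (((1/2) * H x + (1/2) * H' x)
        - Pstar (\<lambda>x. (1/2) * H x + (1/2) * H' x) x)"
      using H(2) H'(2) Pstar_lincomb[OF H(1) H'(1), of "1/2" "1/2"]
      by eventually_elim (simp add: field_simps)
    moreover have "(\<lambda>x. (1/2) * H x + (1/2) * H' x) \<in> L2 M" by (intro L2_lincomb H H')
    moreover have "(\<lambda>x. (1/2) * u x + (1/2) * u' x) \<in> L2 M" by (intro L2_lincomb W_L2 that)
    ultimately show ?thesis unfolding W_def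
      by (intro CollectI conjI bexI[of _ "\<lambda>x. (1/2) * H x + (1/2) * H' x"])
  qed
  have W_shift: "(\<lambda>x. 1 * u x + t * (G x - Pstar G x)) \<in> W" if "u \<in> W" "G \<in> L2 M" for u G t
  proof -
    from that obtain H where H: "H \<in> L2 M" "AE x in M. u x = F x - (H x - Pstar H x)"
      by (auto simp: W_def)
    have "AE x in M. 1 * u x + t * (G x - Pstar G x) = F x - ((1 * H x + (- t) * G x)
        - Pstar (\<lambda>x. 1 * H x + (- t) * G x) x)"
      using H(2) Pstar_lincomb[OF H(1) that(2), of 1 "- t"]
      by eventually_elim (simp add: algebra_simps)
    moreover have "(\<lambda>x. 1 * H x + (- t) * G x) \<in> L2 M" by (intro L2_lincomb H that)
    moreover have "(\<lambda>x. 1 * u x + t * (G x - Pstar G x)) \<in> L2 M"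
      by (intro L2_lincomb L2_diff Pstar_L2 W_L2 that)
    ultimately show ?thesis unfolding W_def
      by (intro CollectI conjI bexI[of _ "\<lambda>x. 1 * H x + (- t) * G x"])
  qed
  define d where "d = Inf ((\<lambda>u. L2_inner M u u) ` W)"
  \<comment> \<open>The choice \<open>H = 0\<close> shows that \<open>W\<close> is nonempty;
    \<open>Pstar\<close> of zero is kept because it vanishes only almost everywhere.\<close>
  have F_W: "(\<lambda>x. F x - (0 - Pstar (\<lambda>_. 0) x)) \<in> W"
    unfolding W_def
    by (intro CollectI conjI bexI[of _ "\<lambda>_. 0"] L2_diff F Pstar_L2 L2_const AE_I2 refl)
  have bdd: "bdd_below ((\<lambda>u. L2_inner M u u) ` W)"
    by (rule bdd_belowI[of _ 0]) (auto simp: L2_inner_self_nonneg)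
  have d_le: "d \<le> L2_inner M u u" if "u \<in> W" for u
    unfolding d_def using that bdd by (intro cInf_lower) auto
  have "\<exists>u\<in>W. L2_inner M u u < d + 1 / real (Suc n)" for n
  proof -
    have "Inf ((\<lambda>u. L2_inner M u u) ` W) < d + 1 / real (Suc n)" by (simp add: d_def)
    then show ?thesis using F_W bdd by (subst (asm) cInf_less_iff) auto
  qed
  then obtain u where uW: "\<And>n. u n \<in> W" and u_le: "\<And>n. L2_inner M (u n) (u n) < d + 1 / real (Suc n)"
    by metis
  have u: "u n \<in> L2 M" for n using uW W_L2 by blast
  have Cauchy: "\<exists>N. \<forall>i\<ge>N. \<forall>j\<ge>N. L2_norm M (\<lambda>x. u i x - u j x) < e" if "e > 0" for e
  proof -
    \<comment> \<open>Midpoints stay in \<open>W\<close> and have square norm at least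
      \<open>d\<close>, so by the parallelogram law |u i - u j|^2 is below 2 / Suc i + 2 / Suc j,
      hence below 4 / Suc N.\<close>
    obtain N where N: "4 / real (Suc N) < e\<^sup>2"
    proof -
      obtain n where "n > 0" "inverse (real n) < e\<^sup>2 / 4"
        using ex_inverse_of_nat_less[of "e\<^sup>2 / 4"] \<open>e > 0\<close> by auto
      then have "4 / real n < e\<^sup>2" by (simp add: field_simps)
      then show ?thesis using that[of "n - 1"] \<open>n > 0\<close> by simp
    qed
    have "L2_norm M (\<lambda>x. u i x - u j x) < e" if "i \<ge> N" "j \<ge> N" for i j
    proof -
      have "d \<le> L2_inner M (\<lambda>x. (1/2) * u i x + (1/2) * u j x) (\<lambda>x. (1/2) * u i x + (1/2) * u j x)"
        by (intro d_le W_mid uW)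
      also have "\<dots> = (L2_inner M (u i) (u i) + 2 * L2_inner M (u i) (u j) + L2_inner M (u j) (u j)) / 4"
        unfolding L2_inner_lincomb_left[OF u[of i] u[of j] L2_lincomb[OF u[of i] u[of j]]]
          L2_inner_lincomb_right[OF u[of i] u[of j] u[of i]]
          L2_inner_lincomb_right[OF u[of i] u[of j] u[of j]] L2_inner_commute[of M "u j" "u i"]
        by (simp add: field_simps)
      finally have "4 * d \<le> L2_inner M (u i) (u i) + 2 * L2_inner M (u i) (u j) + L2_inner M (u j) (u j)"
        by simp
      moreover have "(L2_norm M (\<lambda>x. u i x - u j x))\<^sup>2
          = L2_inner M (u i) (u i) - 2 * L2_inner M (u i) (u j) + L2_inner M (u j) (u j)"
        unfolding L2_norm_square L2_inner_diff_left[OF u[of i] u[of j] L2_diff[OF u[of i] u[of j]]]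
          L2_inner_diff_right[OF u[of i] u[of j] u[of i]]
          L2_inner_diff_right[OF u[of i] u[of j] u[of j]] L2_inner_commute[of M "u j" "u i"]
        by simp
      moreover have "1 / real (Suc i) \<le> 1 / real (Suc N)" "1 / real (Suc j) \<le> 1 / real (Suc N)"
        using that by (auto simp: divide_simps)
      ultimately have "(L2_norm M (\<lambda>x. u i x - u j x))\<^sup>2 < e\<^sup>2"
        using u_le[of i] u_le[of j] N by linarith
      then show ?thesis by (rule power2_less_imp_less) (use \<open>e > 0\<close> in auto)
    qed
    then show ?thesis by blast
  qed
  obtain v where v: "v \<in> L2 M" and lim: "(\<lambda>n. L2_norm M (\<lambda>x. u n x - v x)) \<longlonglongrightarrow> 0"
    by (rule L2_complete[OF u Cauchy])
  have inner_lim: "(\<lambda>n. L2_inner M (u n) c) \<longlonglongrightarrow> L2_inner M v c" if c: "c \<in> L2 M" for c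
  proof -
    have "(\<lambda>n. L2_norm M (\<lambda>x. u n x - v x) * L2_norm M c) \<longlonglongrightarrow> 0"
      using tendsto_mult[OF lim tendsto_const] by simp
    then have "(\<lambda>n. L2_inner M (u n) c - L2_inner M v c) \<longlonglongrightarrow> 0"
      using L2_Cauchy_Schwarz[OF L2_diff[OF u v] c]
      by (elim Lim_null_comparison[rotated])
        (auto simp: L2_inner_diff_left[OF u v c])
    then show ?thesis by (simp add: LIM_zero_iff)
  qed
  have orth: "L2_inner M v (\<lambda>x. G x - Pstar G x) = 0" if G: "G \<in> L2 M" for G
  proof -
    let ?c = "\<lambda>x. G x - Pstar G x"
    let ?b = "L2_inner M v ?c" and ?a = "L2_inner M ?c ?c"
    have c: "?c \<in> L2 M" by (intro L2_diff Pstar_L2 G)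
    \<comment> \<open>First variation at the minimiser: near-minimality of \<open>u n\<close> is
      tested along the direction \<open>?c\<close>, and then \<open>n\<close> tends to
      infinity.\<close>
    have quad: "0 \<le> 2 * t * ?b + t\<^sup>2 * ?a" for t
    proof -
      have "0 \<le> 1 / real (Suc n) + 2 * t * L2_inner M (u n) ?c + t\<^sup>2 * ?a" for n
      proof -
        have "d \<le> L2_inner M (\<lambda>x. 1 * u n x + t * ?c x) (\<lambda>x. 1 * u n x + t * ?c x)"
          by (intro d_le W_shift uW G)
        also have "\<dots> = L2_inner M (u n) (u n) + 2 * t * L2_inner M (u n) ?c + t\<^sup>2 * ?a"
          unfolding L2_inner_lincomb_left[OF u[of n] c L2_lincomb[OF u[of n] c]]
            L2_inner_lincomb_right[OF u[of n] c u[of n]] L2_inner_lincomb_right[OF u[of n] c c]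
            L2_inner_commute[of M ?c "u n"]
          by (simp add: power2_eq_square algebra_simps)
        finally show ?thesis using u_le[of n] by linarith
      qed
      moreover have "(\<lambda>n. 1 / real (Suc n) + 2 * t * L2_inner M (u n) ?c + t\<^sup>2 * ?a)
          \<longlonglongrightarrow> 0 + 2 * t * ?b + t\<^sup>2 * ?a"
        using LIMSEQ_inverse_real_of_nat
        by (intro tendsto_intros inner_lim c) (simp add: inverse_eq_divide)
      ultimately show ?thesis
        by (intro LIMSEQ_le_const) auto
    qed
    have a: "?a \<ge> 0" by (rule L2_inner_self_nonneg)
    \<comment> \<open>The optimal \<open>t\<close> would be -?b / ?a; the denominator ?a + 1 avoids
      dividing by zero and still makes the value negative unless ?b = 0.\<close>
    have "2 * (- ?b / (?a + 1)) * ?b + (- ?b / (?a + 1))\<^sup>2 * ?a = - (?b\<^sup>2 * (?a + 2) / (?a + 1)\<^sup>2)"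
      using a by (simp add: power2_eq_square divide_simps) (simp add: algebra_simps)
    with quad[of "- ?b / (?a + 1)"] have "?b\<^sup>2 * (?a + 2) / (?a + 1)\<^sup>2 \<le> 0" by linarith
    then have "?b\<^sup>2 * (?a + 2) \<le> 0" using a by (simp add: divide_le_0_iff)
    then have "?b\<^sup>2 \<le> 0" using a by (simp add: mult_le_0_iff)
    then show "?b = 0" by simp
  qed
  \<comment> \<open>Orthogonality says <v, h> = <v, Pstar h> = <P v, h> for every
    \<open>h\<close>.\<close>
  have "AE x in M. P v x = v x"
  proof (rule L2_eqI_AE[OF P_L2[OF v] v])
    fix h assume h: "h \<in> L2 M"
    show "L2_inner M (P v) h = L2_inner M v h"
      using orth[OF h] Pstar_inner[OF v h]
      by (simp add: L2_inner_diff_right[OF h Pstar_L2[OF h] v] L2_inner_commute)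
  qed
  then obtain c where c: "AE x in M. v x = c"
    using ergodic v by (auto simp: ergodic_op_def)
  have "expectation (u n) = 0" for n
  proof -
    obtain H where H: "H \<in> L2 M" and eq: "AE x in M. u n x = F x - (H x - Pstar H x)"
      using uW[of n] by (auto simp: W_def)
    have "expectation (u n) = expectation (\<lambda>x. F x - (H x - Pstar H x))"
      using eq by (intro integral_cong_AE L2_measurable L2_diff F H Pstar_L2 u) auto
    also have "\<dots> = 0"
      using L2_integrable[OF F] L2_integrable[OF H] L2_integrable[OF Pstar_L2[OF H]]
      by (simp add: EF expectation_Pstar[OF H])
    finally show ?thesis .
  qed
  then have "expectation v = 0"
    using inner_lim[OF L2_const[of 1]] LIMSEQ_unique[OF _ tendsto_const] by (simp add: L2_inner_1) blast
  moreover have "expectation v = expectation (\<lambda>_. c)"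
    using c by (intro integral_cong_AE L2_measurable[OF v]) auto
  ultimately have v0: "AE x in M. v x = 0" using c by (simp add: prob_space)
  obtain n where n: "L2_norm M (\<lambda>x. u n x - v x) < \<kappa>"
    using order_tendstoD(2)[OF lim \<open>\<kappa> > 0\<close>] by (auto simp: eventually_sequentially)
  obtain H where H: "H \<in> L2 M" and eq: "AE x in M. u n x = F x - (H x - Pstar H x)"
    using uW[of n] by (auto simp: W_def)
  have "L2_norm M (\<lambda>x. F x - (H x - Pstar H x)) = L2_norm M (\<lambda>x. u n x - v x)"
    using eq v0 by (intro L2_norm_cong_AE L2_diff F H Pstar_L2 u v) auto
  with n H show ?thesis by (intro that) auto
qed

text \<open>A coboundary pairs with \<open>g\<close> as <H - Pstar H, g> = -<H, P g - g>, which is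
  small if \<open>g\<close> is almost invariant, and the centred \<open>F\<close> is a coboundary up
  to a small error. The threshold depends on \<open>F\<close> through \<open>H\<close>, but not on
  \<open>g\<close>.\<close>

lemma decorrelation:
  assumes F: "F \<in> L2 M" and "\<kappa> > 0"
  obtains \<eta> where "\<eta> > 0"
    "\<forall>g\<in>borel_measurable M. (\<forall>x. 0 \<le> g x \<and> g x \<le> 1) \<longrightarrow> defect g \<le> \<eta> \<longrightarrow>
      \<bar>expectation (\<lambda>x. F x * g x) - expectation F * expectation g\<bar> \<le> \<kappa>"
proof -
  let ?F = "\<lambda>x. F x - expectation F"
  have F0: "?F \<in> L2 M" by (intro L2_diff F L2_const)
  have "expectation ?F = 0" using L2_integrable[OF F] by (simp add: prob_space)
  then obtain H where H: "H \<in> L2 M" and small: "L2_norm M (\<lambda>x. ?F x - (H x - Pstar H x)) \<le> \<kappa> / 2"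
    using coboundaries_dense[OF F0, of "\<kappa> / 2"] \<open>\<kappa> > 0\<close> by auto
  let ?w = "\<lambda>x. ?F x - (H x - Pstar H x)"
  note PH = Pstar_L2[OF H]
  have HP: "(\<lambda>x. H x - Pstar H x) \<in> L2 M" by (intro L2_diff H PH)
  have w: "?w \<in> L2 M" by (intro L2_diff F0 HP)
  \<comment> \<open>Half of \<kappa> is reserved for the approximation error and half for the
    pairing with \<open>H\<close>; the summand 1 covers a vanishing \<open>H\<close>. The threshold
    \<open>\<alpha>\<^sup>2 / 2\<close> inverts \<open>norm_P_diff_le_defect\<close>.\<close>
  define \<alpha> where "\<alpha> = \<kappa> / (2 * (L2_norm M H + 1))"
  have \<alpha>: "\<alpha> > 0" using \<open>\<kappa> > 0\<close> L2_norm_nonneg[of M H] by (simp add: \<alpha>_def)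
  show ?thesis
  proof (rule that[of "\<alpha>\<^sup>2 / 2"])
    show "\<alpha>\<^sup>2 / 2 > 0" using \<alpha> by simp
  next
    show "\<forall>g\<in>borel_measurable M. (\<forall>x. 0 \<le> g x \<and> g x \<le> 1) \<longrightarrow> defect g \<le> \<alpha>\<^sup>2 / 2 \<longrightarrow>
      \<bar>expectation (\<lambda>x. F x * g x) - expectation F * expectation g\<bar> \<le> \<kappa>"
    proof (intro ballI impI)
      fix g assume gm: "g \<in> borel_measurable M" and "\<forall>x. 0 \<le> g x \<and> g x \<le> 1"
        and defect: "defect g \<le> \<alpha>\<^sup>2 / 2"
      then have g01: "\<And>x. 0 \<le> g x \<and> g x \<le> 1" by blast
      have g: "g \<in> L2 M" by (rule L2_bounded[OF gm, where K = 1]) (use g01 in auto)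
      have "L2_norm M g \<le> L2_norm M (\<lambda>_. 1)"
        using g01 by (intro L2_norm_mono g L2_const) auto
      then have g1: "L2_norm M g \<le> 1" by (simp add: L2_norm_const)
      have "(L2_norm M (\<lambda>x. P g x - g x))\<^sup>2 \<le> \<alpha>\<^sup>2"
        using norm_P_diff_le_defect[OF gm g01] defect by simp
      then have Pg: "L2_norm M (\<lambda>x. P g x - g x) \<le> \<alpha>" by (rule power2_le_imp_le) (use \<alpha> in auto)
      have "expectation (\<lambda>x. F x * g x) - expectation F * expectation g = L2_inner M ?F g"
        using L2_mult_integrable[OF F g] L2_integrable[OF g] by (simp add: L2_inner_def left_diff_distrib)
      also have "\<dots> = L2_inner M ?w g + (L2_inner M H g - L2_inner M (Pstar H) g)"
        unfolding L2_inner_diff_left[OF F0 HP g] L2_inner_diff_left[OF H PH g] by simp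
      also have "L2_inner M H g - L2_inner M (Pstar H) g = - L2_inner M H (\<lambda>x. P g x - g x)"
        by (simp add: L2_inner_diff_right[OF P_L2[OF g] g H] Pstar_inner[OF g H])
      finally have eq: "expectation (\<lambda>x. F x * g x) - expectation F * expectation g
          = L2_inner M ?w g - L2_inner M H (\<lambda>x. P g x - g x)" by simp
      have "\<bar>L2_inner M ?w g\<bar> \<le> L2_norm M ?w * L2_norm M g" by (rule L2_Cauchy_Schwarz[OF w g])
      also have "\<dots> \<le> (\<kappa> / 2) * 1" using \<open>\<kappa> > 0\<close> by (intro mult_mono small g1 L2_norm_nonneg) auto
      finally have 1: "\<bar>L2_inner M ?w g\<bar> \<le> \<kappa> / 2" by simp
      have "\<bar>L2_inner M H (\<lambda>x. P g x - g x)\<bar> \<le> L2_norm M H * L2_norm M (\<lambda>x. P g x - g x)"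
        by (intro L2_Cauchy_Schwarz H L2_diff P_L2 g)
      also have "\<dots> \<le> (L2_norm M H + 1) * \<alpha>"
        using \<alpha> by (intro mult_mono Pg) (auto simp: L2_norm_nonneg)
      also have "\<dots> = \<kappa> / 2"
        using L2_norm_nonneg[of M H] by (simp add: \<alpha>_def divide_simps)
      finally show "\<bar>expectation (\<lambda>x. F x * g x) - expectation F * expectation g\<bar> \<le> \<kappa>"
        unfolding eq using 1 by linarith
    qed
  qed
qed

end

section \<open>Concentrating almost invariant functions\<close>

context ergodic_markov_L2
begin

text \<open>Multiplying by a nearly independent factor of variance at least \<open>v\<close> decreases the
  ratio \<open>\<mu>(G)\<^sup>2 / \<mu>(G\<^sup>2)\<close> by the factor \<open>1 - v / 2\<close>.\<close>

lemma almost_invariant_products: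
  assumes "v > 0"
    and factors: "\<And>\<delta>. \<delta> > 0 \<Longrightarrow> \<exists>g. g \<in> borel_measurable M \<and> (\<forall>x. 0 \<le> g x \<and> g x \<le> 1) \<and>
      L2_inner M g g - (expectation g)\<^sup>2 \<ge> v \<and> defect g \<le> \<delta>"
  shows "\<exists>c>0. \<forall>\<delta>>0. \<exists>G. G \<in> borel_measurable M \<and> (\<forall>x. 0 \<le> G x \<and> G x \<le> 1) \<and> defect G \<le> \<delta> \<and>
      L2_inner M G G \<ge> c \<and> (expectation G)\<^sup>2 \<le> (1 - v / 2) ^ k * L2_inner M G G"
proof (induction k)
  case 0
  have "defect (\<lambda>_. 1) = 0"
    unfolding defect_def using P_1 L2_measurable[OF P_L2[OF L2_const[of 1]]]
    by (subst integral_cong_AE[where g = "\<lambda>_. 0"]) auto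
  then show ?case
    by (intro exI[of _ 1] conjI allI impI exI[of _ "\<lambda>_. 1"]) (auto simp: L2_inner_def prob_space)
next
  case (Suc k)
  define r where "r = 1 - v / 2"
  have L2_01: "g \<in> L2 M" if "g \<in> borel_measurable M" "\<forall>x. 0 \<le> g x \<and> g x \<le> 1" for g
    by (rule L2_bounded[OF that(1), where K = 1]) (use that(2) in auto)
  have le1: "L2_inner M g g \<le> 1" "0 \<le> expectation g" "expectation g \<le> 1"
    if "g \<in> borel_measurable M" "\<forall>x. 0 \<le> g x \<and> g x \<le> 1" for g
  proof -
    note g = L2_01[OF that]
    have "L2_inner M g g \<le> L2_inner M (\<lambda>_. 1) (\<lambda>_. 1)"
      using that(2) by (intro L2_inner_mono g L2_const AE_I2) (auto intro: mult_le_one)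
    then show "L2_inner M g g \<le> 1" by (simp add: L2_inner_def prob_space)
    show "0 \<le> expectation g" using that(2) by simp
    have "expectation g \<le> expectation (\<lambda>_. 1)"
      using that(2) by (intro integral_mono L2_integrable g L2_const) auto
    then show "expectation g \<le> 1" by (simp add: prob_space)
  qed
  have "v \<le> 1"
  proof -
    obtain g where g: "g \<in> borel_measurable M" "\<forall>x. 0 \<le> g x \<and> g x \<le> 1"
      "L2_inner M g g - (expectation g)\<^sup>2 \<ge> v" using factors[of 1] by auto
    then show ?thesis using le1(1)[OF g(1,2)] zero_le_power2[of "expectation g"] by linarith
  qed
  then have r: "r > 0" "r \<le> 1" using \<open>v > 0\<close> by (auto simp: r_def)
  from Suc obtain c where c: "c > 0" and IH: "\<And>\<delta>. \<delta> > 0 \<Longrightarrow>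
      \<exists>G. G \<in> borel_measurable M \<and> (\<forall>x. 0 \<le> G x \<and> G x \<le> 1) \<and> defect G \<le> \<delta> \<and>
      L2_inner M G G \<ge> c \<and> (expectation G)\<^sup>2 \<le> r ^ k * L2_inner M G G"
    unfolding r_def by blast
  \<comment> \<open>Tuned so that 4 * \<kappa> is at most the gain
    \<open>r ^ k * (c * v) * (v / 2)\<close>; the cap at 1 gives \<kappa>^2 \<le> \<kappa>.\<close>
  define \<kappa> where "\<kappa> = min 1 (r ^ k * c * v\<^sup>2 / 8)"
  have \<kappa>: "\<kappa> > 0" "\<kappa> \<le> 1" "8 * \<kappa> \<le> r ^ k * c * v\<^sup>2"
    using r c \<open>v > 0\<close> by (auto simp: \<kappa>_def)
  have rk: "0 < r ^ k" "r ^ k \<le> 1" using r by (auto intro: power_le_one)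
  have \<kappa>c: "\<kappa> \<le> c * v / 2"
  proof -
    have "8 * \<kappa> \<le> r ^ k * (c * v\<^sup>2)" using \<kappa>(3) by (simp add: mult.assoc)
    also have "\<dots> \<le> 1 * (c * v\<^sup>2)" using rk c by (intro mult_right_mono) auto
    also have "\<dots> \<le> c * v" using c \<open>v > 0\<close> \<open>v \<le> 1\<close> by (simp add: power2_eq_square mult_le_one)
    finally show ?thesis using \<kappa>(1) by linarith
  qed
  \<comment> \<open>The new lower bound is fixed before \<delta> is given: only the defect may
    depend on \<delta>, never the size of the function.\<close>
  have "\<exists>G. G \<in> borel_measurable M \<and> (\<forall>x. 0 \<le> G x \<and> G x \<le> 1) \<and> defect G \<le> \<delta> \<and>
      L2_inner M G G \<ge> c * v / 2 \<and> (expectation G)\<^sup>2 \<le> r ^ Suc k * L2_inner M G G"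
    if "\<delta> > 0" for \<delta>
  proof -
    obtain G where Gm [measurable]: "G \<in> borel_measurable M" and G01: "\<forall>x. 0 \<le> G x \<and> G x \<le> 1"
      and G\<delta>: "defect G \<le> \<delta> / 8" and Gc: "L2_inner M G G \<ge> c"
      and GE: "(expectation G)\<^sup>2 \<le> r ^ k * L2_inner M G G"
      using IH[of "\<delta> / 8"] \<open>\<delta> > 0\<close> by auto
    have G: "G \<in> L2 M" by (rule L2_01[OF Gm G01])
    have G2: "(\<lambda>x. (G x)\<^sup>2) \<in> L2 M"
      using G01 by (intro L2_01) (auto simp: power_le_one)
    obtain \<eta>1 where \<eta>1: "\<eta>1 > 0" and dec1: "\<forall>g\<in>borel_measurable M.
        (\<forall>x. 0 \<le> g x \<and> g x \<le> 1) \<longrightarrow> defect g \<le> \<eta>1 \<longrightarrow>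
        \<bar>expectation (\<lambda>x. G x * g x) - expectation G * expectation g\<bar> \<le> \<kappa>"
      by (rule decorrelation[OF G \<kappa>(1)])
    obtain \<eta>2 where \<eta>2: "\<eta>2 > 0" and dec2: "\<forall>g\<in>borel_measurable M.
        (\<forall>x. 0 \<le> g x \<and> g x \<le> 1) \<longrightarrow> defect g \<le> \<eta>2 \<longrightarrow>
        \<bar>expectation (\<lambda>x. (G x)\<^sup>2 * g x) - expectation (\<lambda>x. (G x)\<^sup>2) * expectation g\<bar> \<le> \<kappa>"
      by (rule decorrelation[OF G2 \<kappa>(1)])
    \<comment> \<open>The factor is chosen after \<open>G\<close>, whose decorrelation thresholds it
      must meet. Multiplication costs a factor 4 on the sum of two defects, whence \<delta> / 8;
      squaring costs a factor 4, whence \<eta>2 / 4.\<close>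
    obtain g where gm [measurable]: "g \<in> borel_measurable M" and g01: "\<forall>x. 0 \<le> g x \<and> g x \<le> 1"
      and gv: "L2_inner M g g - (expectation g)\<^sup>2 \<ge> v"
      and gd: "defect g \<le> min (\<delta> / 8) (min \<eta>1 (\<eta>2 / 4))"
      using factors[of "min (\<delta> / 8) (min \<eta>1 (\<eta>2 / 4))"] \<eta>1 \<eta>2 \<open>\<delta> > 0\<close> by auto
    let ?G = "\<lambda>x. G x * g x"
    let ?a = "expectation G" and ?b = "expectation g"
    let ?A = "L2_inner M G G" and ?B = "L2_inner M g g"
    have \<delta>: "defect ?G \<le> \<delta>"
      using defect_mult_le[OF Gm gm] G01 g01 G\<delta> gd by force
    have d1: "\<bar>expectation ?G - ?a * ?b\<bar> \<le> \<kappa>"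
      using dec1 gm g01 gd by auto
    have d2: "\<bar>L2_inner M ?G ?G - ?A * ?B\<bar> \<le> \<kappa>"
    proof -
      have "defect (\<lambda>x. (g x)\<^sup>2) \<le> 4 * 1 * defect g"
        using g01 by (intro defect_square_le gm) auto
      then have "defect (\<lambda>x. (g x)\<^sup>2) \<le> \<eta>2" using gd by auto
      then have "\<bar>expectation (\<lambda>x. (G x)\<^sup>2 * (g x)\<^sup>2)
          - expectation (\<lambda>x. (G x)\<^sup>2) * expectation (\<lambda>x. (g x)\<^sup>2)\<bar> \<le> \<kappa>"
        using g01 by (intro dec2[rule_format]) (auto simp: power_le_one)
      then show ?thesis by (simp add: L2_inner_self power_mult_distrib)
    qed
    have B: "v \<le> ?B" using gv zero_le_power2[of ?b] by linarith
    have B1: "?B \<le> 1" using le1(1)[OF gm g01] .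
    have AB: "c * v \<le> ?A * ?B" using Gc B c \<open>v > 0\<close> by (intro mult_mono) auto
    have low: "L2_inner M ?G ?G \<ge> c * v / 2" using AB d2 \<kappa>c by linarith
    have ab: "0 \<le> ?a * ?b" "?a * ?b \<le> 1"
      using le1(2,3)[OF Gm G01] le1(2,3)[OF gm g01] by (auto intro: mult_le_one)
    have E0: "0 \<le> expectation ?G" using G01 g01 by (intro integral_nonneg_AE) auto
    have "(expectation ?G)\<^sup>2 \<le> (?a * ?b + \<kappa>)\<^sup>2"
      using d1 E0 by (intro power_mono) auto
    also have "\<dots> = (?a * ?b)\<^sup>2 + 2 * ((?a * ?b) * \<kappa>) + \<kappa> * \<kappa>"
      by (simp add: power2_eq_square algebra_simps)
    also have "\<dots> \<le> (?a * ?b)\<^sup>2 + 2 * (1 * \<kappa>) + 1 * \<kappa>"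
      using ab \<kappa> by (intro add_mono mult_left_mono mult_right_mono) auto
    also have "(?a * ?b)\<^sup>2 = ?a\<^sup>2 * ?b\<^sup>2" by (simp add: power_mult_distrib)
    also have "?a\<^sup>2 * ?b\<^sup>2 \<le> (r ^ k * ?A) * (?B - v)"
      using GE gv rk Gc c by (intro mult_mono) auto
    also have "\<dots> \<le> (r ^ k * ?A) * (?B * (1 - v))"
    proof (rule mult_left_mono)
      \<comment> \<open>This replaces ?B - v by a multiple of ?B, using ?B \<le> 1, so that the
        decrease becomes multiplicative.\<close>
      have "?B * v \<le> 1 * v" using B1 \<open>v > 0\<close> by (intro mult_right_mono) auto
      then show "?B - v \<le> ?B * (1 - v)" by (simp add: algebra_simps)
    qed (use rk Gc c in auto)
    finally have up: "(expectation ?G)\<^sup>2 \<le> r ^ k * (?A * ?B) * (1 - v) + 3 * \<kappa>"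
      by (simp add: mult.assoc)
    have "r ^ k * (?A * ?B) * (v / 2) \<ge> r ^ k * (c * v) * (v / 2)"
      using rk \<open>v > 0\<close> by (intro mult_right_mono mult_left_mono AB) auto
    then have gain: "r ^ k * (?A * ?B) * (v / 2) \<ge> 4 * \<kappa>"
      using \<kappa>(3) by (simp add: power2_eq_square mult.assoc)
    have rSk: "0 \<le> r ^ Suc k" "r ^ Suc k \<le> 1" using r by (auto intro: power_le_one simp del: power_Suc)
    \<comment> \<open>Half of the decrease \<open>v\<close> is kept in r = 1 - v / 2; the other half
      is worth 4 * \<kappa> and pays the error 3 * \<kappa> in the mean and \<kappa> in the square
      norm.\<close>
    have "r ^ k * (?A * ?B) * (1 - v) + 3 * \<kappa> \<le> r ^ Suc k * (?A * ?B) - \<kappa>"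
      using gain by (simp add: r_def algebra_simps)
    also have "\<dots> \<le> r ^ Suc k * (?A * ?B) - r ^ Suc k * \<kappa>"
      using mult_right_mono[OF rSk(2), of \<kappa>] \<kappa>(1) by simp
    also have "\<dots> = r ^ Suc k * (?A * ?B - \<kappa>)" by (simp add: algebra_simps)
    also have "\<dots> \<le> r ^ Suc k * L2_inner M ?G ?G"
      using d2 rSk(1) by (intro mult_left_mono) auto
    finally have "(expectation ?G)\<^sup>2 \<le> r ^ Suc k * L2_inner M ?G ?G" using up by linarith
    moreover have "\<forall>x. 0 \<le> ?G x \<and> ?G x \<le> 1" using G01 g01 by (auto intro: mult_le_one)
    ultimately show ?thesis using \<delta> low by (intro exI[of _ ?G] conjI) auto
  qed
  then show ?case
    using c \<open>v > 0\<close> unfolding r_def by (intro exI[of _ "c * v / 2"]) auto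
qed

text \<open>The first hypothesis is failure of the Poincare inequality for every constant. Both
  bounds in the conclusion are homogeneous of degree two, so normalisation can wait.\<close>

lemma concentrating_functions:
  assumes no_gap: "\<And>\<eta>. \<eta> > 0 \<Longrightarrow> \<exists>f\<in>L2 M. \<eta> * (L2_inner M f f - (expectation f)\<^sup>2) > form f"
    and "\<epsilon> > 0"
  shows "\<exists>f\<in>L2 M. (\<forall>x. f x \<ge> 0) \<and> 0 < L2_inner M f f \<and> form f \<le> \<epsilon> * L2_inner M f f \<and>
    (expectation f)\<^sup>2 \<le> \<epsilon> * L2_inner M f f"
proof -
  have normalized: "\<exists>f\<in>L2 M. expectation f = 0 \<and> L2_inner M f f = 1 \<and> form f \<le> \<eta>" if "\<eta> > 0" for \<eta>
  proof -
    obtain f where f: "f \<in> L2 M" and gap: "\<eta> * (L2_inner M f f - (expectation f)\<^sup>2) > form f"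
      using no_gap[OF \<open>\<eta> > 0\<close>] by blast
    let ?g = "\<lambda>x. f x - expectation f"
    define V where "V = L2_inner M ?g ?g"
    have g: "?g \<in> L2 M" by (intro L2_diff f L2_const)
    have V: "V = L2_inner M f f - (expectation f)\<^sup>2"
      using L2_norm_centered[OF f] by (simp add: V_def L2_norm_square)
    have "\<eta> * V > 0" using gap form_nonneg[OF f] unfolding V by linarith
    then have V0: "V > 0" using \<open>\<eta> > 0\<close> by (simp add: zero_less_mult_iff)
    have fg: "form ?g = form f" using form_add_const[OF f, of "- expectation f"] by simp
    let ?h = "\<lambda>x. (1 / sqrt V) * ?g x"
    have "?h \<in> L2 M" by (intro L2_cmult g)
    moreover have "expectation ?h = 0" using L2_integrable[OF f] by (simp add: prob_space)
    moreover have "L2_inner M ?h ?h = 1"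
      unfolding L2_inner_cmult_left L2_inner_cmult_right using V0 by (simp flip: V_def)
    moreover have "form ?h \<le> \<eta>"
      unfolding form_cmult[OF g] fg using V0 gap by (simp add: power_divide divide_le_eq flip: V)
    ultimately show ?thesis by blast
  qed
  \<comment> \<open>This gives 1 / K^2 = \<epsilon> / 16, matching the threshold 1/16 for the square
    norm of the overshoot.\<close>
  define K where "K = 4 / sqrt \<epsilon>"
  have K: "K > 0" "K\<^sup>2 = 16 / \<epsilon>" using \<open>\<epsilon> > 0\<close> by (auto simp: K_def power_divide)
  have uL2: "(\<lambda>x. max (\<bar>f x\<bar> + (- K)) 0) \<in> L2 M" if "f \<in> L2 M" for f
    by (intro L2_max_0 L2_add L2_abs that L2_const)
  show ?thesis
  proof (cases "\<exists>f\<in>L2 M. L2_inner M f f = 1 \<and> form f \<le> \<epsilon> / 16 \<and>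
      1 / 16 \<le> L2_inner M (\<lambda>x. max (\<bar>f x\<bar> + (- K)) 0) (\<lambda>x. max (\<bar>f x\<bar> + (- K)) 0)")
    case True
    then obtain f where f: "f \<in> L2 M" and f1: "L2_inner M f f = 1" and ff: "form f \<le> \<epsilon> / 16"
      and fu: "1 / 16 \<le> L2_inner M (\<lambda>x. max (\<bar>f x\<bar> + (- K)) 0) (\<lambda>x. max (\<bar>f x\<bar> + (- K)) 0)" by blast
    let ?u = "\<lambda>x. max (\<bar>f x\<bar> + (- K)) 0"
    have "form ?u \<le> form (\<lambda>x. \<bar>f x\<bar> + (- K))" by (intro form_max_0 L2_add L2_abs f L2_const)
    also have "\<dots> = form (\<lambda>x. \<bar>f x\<bar>)" by (intro form_add_const L2_abs f)
    also have "\<dots> \<le> \<epsilon> / 16" using form_abs[OF f] ff by linarith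
    also have "\<dots> \<le> \<epsilon> * L2_inner M ?u ?u" using mult_left_mono[OF fu, of \<epsilon>] \<open>\<epsilon> > 0\<close> by simp
    finally have 1: "form ?u \<le> \<epsilon> * L2_inner M ?u ?u" .
    have "expectation ?u \<le> expectation (\<lambda>x. (1 / K) * (f x)\<^sup>2)"
    proof (rule integral_mono)
      fix x
      \<comment> \<open>Elementary bound (|f| - K)^+ \<le> f^2 / K, from 2 * K * |f| \<le> K^2 +
        f^2; it makes the mean of the overshoot small without any further information on
        \<open>f\<close>.\<close>
      have "K * \<bar>f x\<bar> \<le> K * K + \<bar>f x\<bar> * \<bar>f x\<bar>"
        using sum_squares_bound[of K "\<bar>f x\<bar>"] mult_nonneg_nonneg[OF less_imp_le[OF K(1)] abs_ge_zero, of "f x"]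
        unfolding power2_eq_square mult.assoc by linarith
      then show "?u x \<le> (1 / K) * (f x)\<^sup>2"
        using K(1) by (simp add: divide_simps power2_eq_square algebra_simps max_def)
    qed (use L2_integrable[OF uL2[OF f]] L2_integrable_square[OF f] in auto)
    also have "\<dots> = 1 / K" using f1 by (simp add: L2_inner_self)
    finally have "(expectation ?u)\<^sup>2 \<le> (1 / K)\<^sup>2" by (intro power_mono) auto
    also have "\<dots> = \<epsilon> / 16" using K(2) by (simp add: power_divide)
    also have "\<dots> \<le> \<epsilon> * L2_inner M ?u ?u" using mult_left_mono[OF fu, of \<epsilon>] \<open>\<epsilon> > 0\<close> by simp
    finally have 2: "(expectation ?u)\<^sup>2 \<le> \<epsilon> * L2_inner M ?u ?u" .
    show ?thesis using 1 2 fu uL2[OF f] by (intro bexI[of _ ?u]) auto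
  next
    case False
    \<comment> \<open>This is (1 / (2 * K))^2 * (3/4)^2: truncation at \<open>K\<close> leaves a
      standard deviation of at least 3/4, and (g + K) / (2 * K) maps the range into [0, 1].\<close>
    define v where "v = 9 / (64 * K\<^sup>2)"
    have "v > 0" using K(1) by (simp add: v_def)
    have "\<exists>g. g \<in> borel_measurable M \<and> (\<forall>x. 0 \<le> g x \<and> g x \<le> 1) \<and>
      L2_inner M g g - (expectation g)\<^sup>2 \<ge> v \<and> defect g \<le> \<delta>" if "\<delta> > 0" for \<delta>
    proof -
      \<comment> \<open>The bound \<epsilon> / 16 excludes the first case for \<open>f\<close>. The
        other one becomes \<open>\<delta>\<^sup>2 / 2\<close> after rescaling, which is what
        \<open>defect_le_form\<close> needs for a defect of at most \<delta>.\<close>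
      have pos: "0 < min (\<epsilon> / 16) (2 * K\<^sup>2 * \<delta>\<^sup>2)" using K(1) \<open>\<epsilon> > 0\<close> \<open>\<delta> > 0\<close> by simp
      obtain f where f: "f \<in> L2 M" and Ef: "expectation f = 0" and f1: "L2_inner M f f = 1"
        and ff: "form f \<le> min (\<epsilon> / 16) (2 * K\<^sup>2 * \<delta>\<^sup>2)" using normalized[OF pos] by blast
      have fm [measurable]: "f \<in> borel_measurable M" using f by (rule L2_measurable)
      let ?u = "\<lambda>x. max (\<bar>f x\<bar> + (- K)) 0"
      define g where "g x = max (min (f x) K) (- K)" for x
      have gm [measurable]: "g \<in> borel_measurable M" unfolding g_def by measurable
      have gK: "- K \<le> g x" "g x \<le> K" for x using K(1) by (auto simp: g_def)
      have g: "g \<in> L2 M" by (rule L2_bounded[OF gm, where K = K]) (use gK in \<open>auto simp: abs_le_iff minus_le_iff\<close>)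
      have mL2: "(\<lambda>x. min (f x) K) \<in> L2 M"
        by (rule L2_dominated[OF f]) (use K(1) in auto)
      have fg: "form g \<le> form f"
        unfolding g_def using form_max_const[OF mL2, of "- K"] form_min_const[OF f, of K] by linarith
      let ?h = "\<lambda>x. f x - g x"
      have h: "?h \<in> L2 M" by (intro L2_diff f g)
      \<comment> \<open>The truncation error equals the overshoot in absolute value, so its norm is
        at most 1/4. Centring does not increase a norm, and \<open>f\<close> is centred of norm 1,
        so 3/4 remains for \<open>g\<close>.\<close>
      have "L2_inner M ?h ?h = L2_inner M ?u ?u"
      proof -
        have "\<bar>?h x\<bar> = \<bar>?u x\<bar>" for x using K(1) by (auto simp: g_def)
        then have "(?h x)\<^sup>2 = (?u x)\<^sup>2" for x by (metis power2_abs)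
        then show ?thesis unfolding L2_inner_self by simp
      qed
      then have "L2_inner M ?h ?h < 1 / 16" using False f f1 ff by force
      then have "(L2_norm M ?h)\<^sup>2 \<le> (1/4)\<^sup>2" unfolding L2_norm_square by (simp add: power_divide)
      then have h4: "L2_norm M ?h \<le> 1/4" by (rule power2_le_imp_le) simp
      have hc: "L2_norm M (\<lambda>x. ?h x - expectation ?h) \<le> L2_norm M ?h"
        by (rule power2_le_imp_le) (simp_all only: L2_norm_centered[OF h] L2_norm_square[of M ?h] L2_norm_nonneg, simp)
      have Eh: "expectation ?h = - expectation g"
        using L2_integrable[OF f] L2_integrable[OF g] Ef by simp
      have "1 = L2_norm M (\<lambda>x. (g x - expectation g) + (?h x - expectation ?h))"
        unfolding Eh using f1 by (simp add: L2_norm_def)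
      also have "\<dots> \<le> L2_norm M (\<lambda>x. g x - expectation g) + L2_norm M (\<lambda>x. ?h x - expectation ?h)"
        by (intro L2_norm_triangle L2_diff f g L2_const)
      finally have "3/4 \<le> L2_norm M (\<lambda>x. g x - expectation g)" using hc h4 by linarith
      then have "(3/4)\<^sup>2 \<le> (L2_norm M (\<lambda>x. g x - expectation g))\<^sup>2" by (rule power_mono) simp
      then have var: "9/16 \<le> L2_inner M g g - (expectation g)\<^sup>2"
        unfolding L2_norm_centered[OF g] by (simp add: power_divide)
      let ?g = "\<lambda>x. (1 / (2 * K)) * (g x + K)"
      have gc: "(\<lambda>x. g x + K) \<in> L2 M" by (intro L2_add g L2_const)
      have g': "?g \<in> L2 M" by (intro L2_cmult gc)
      have Eg': "expectation ?g = (1 / (2 * K)) * (expectation g + K)"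
        using L2_integrable[OF g] by (simp add: prob_space)
      have "(L2_norm M (\<lambda>x. ?g x - expectation ?g))\<^sup>2 = (L2_norm M (\<lambda>x. (1 / (2 * K)) * (g x - expectation g)))\<^sup>2"
        unfolding Eg' by (intro arg_cong[where f = "\<lambda>u. (L2_norm M u)\<^sup>2"])
            (auto simp: diff_divide_distrib add_divide_distrib)
      also have "\<dots> = (1 / (2 * K))\<^sup>2 * (L2_inner M g g - (expectation g)\<^sup>2)"
        using L2_norm_centered[OF g] by (simp only: L2_norm_cmult power_mult_distrib power2_abs)
      also have "\<dots> \<ge> (1 / (2 * K))\<^sup>2 * (9/16)" by (intro mult_left_mono var) simp
      finally have "(1 / (2 * K))\<^sup>2 * (9/16) \<le> L2_inner M ?g ?g - (expectation ?g)\<^sup>2"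
        by (simp only: L2_norm_centered[OF g'])
      moreover have "(1 / (2 * K))\<^sup>2 * (9/16) = v" by (simp add: v_def power2_eq_square)
      ultimately have 1: "v \<le> L2_inner M ?g ?g - (expectation ?g)\<^sup>2" by simp
      have "form ?g = (1 / (2 * K))\<^sup>2 * form g"
        unfolding form_cmult[OF gc] form_add_const[OF g] ..
      also have "\<dots> \<le> (1 / (2 * K))\<^sup>2 * (2 * K\<^sup>2 * \<delta>\<^sup>2)"
        using fg ff by (intro mult_left_mono) auto
      also have "\<dots> = \<delta>\<^sup>2 / 2" using K(1) by (simp add: power2_eq_square)
      finally have "sqrt (2 * form ?g) \<le> \<delta>" using \<open>\<delta> > 0\<close> by (intro real_le_lsqrt) auto
      then have 2: "defect ?g \<le> \<delta>" using defect_le_form[OF g'] by linarith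
      have 3: "0 \<le> ?g x \<and> ?g x \<le> 1" for x
        using gK[of x] K(1) by (auto simp: divide_simps)
      show ?thesis using 1 2 3 by (intro exI[of _ ?g]) auto
    qed
    note products = almost_invariant_products[OF \<open>v > 0\<close> this]
    obtain k where k: "(1 - v / 2) ^ k \<le> \<epsilon>"
    proof (cases "1 - v / 2 \<ge> 0")
      case True
      then show ?thesis
        using real_arch_pow_inv[OF \<open>\<epsilon> > 0\<close>, of "1 - v / 2"] \<open>v > 0\<close> that
        by (auto dest: less_imp_le)
    next
      case False
      then show ?thesis using that[of 1] \<open>\<epsilon> > 0\<close> by simp
    qed
    obtain c where "c > 0" and c: "\<forall>\<delta>>0. \<exists>G. G \<in> borel_measurable M \<and> (\<forall>x. 0 \<le> G x \<and> G x \<le> 1) \<and> defect G \<le> \<delta> \<and>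
      L2_inner M G G \<ge> c \<and> (expectation G)\<^sup>2 \<le> (1 - v / 2) ^ k * L2_inner M G G"
      using products[of k] by blast
    \<comment> \<open>Because \<open>c\<close> is uniform in the defect, a defect of at most
      \<epsilon> * c is also at most \<epsilon> times the square norm.\<close>
    have "\<epsilon> * c > 0" using \<open>\<epsilon> > 0\<close> \<open>c > 0\<close> by simp
    then obtain G where Gm: "G \<in> borel_measurable M" and G01: "\<forall>x. 0 \<le> G x \<and> G x \<le> 1"
      and Gd: "defect G \<le> \<epsilon> * c" and Gc: "L2_inner M G G \<ge> c"
      and GE: "(expectation G)\<^sup>2 \<le> (1 - v / 2) ^ k * L2_inner M G G"
      using c by blast
    have G: "G \<in> L2 M" by (rule L2_bounded[OF Gm, where K = 1]) (use G01 in auto)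
    have "form G \<le> \<epsilon> * c" using form_le_defect[OF Gm] G01 Gd by force
    also have "\<dots> \<le> \<epsilon> * L2_inner M G G" using Gc \<open>\<epsilon> > 0\<close> by simp
    finally have "form G \<le> \<epsilon> * L2_inner M G G" .
    moreover have "(expectation G)\<^sup>2 \<le> \<epsilon> * L2_inner M G G"
      using GE mult_right_mono[OF k L2_inner_self_nonneg[of M G]] by linarith
    ultimately show ?thesis using G G01 Gc \<open>c > 0\<close> by (intro bexI[of _ G]) auto
  qed
qed

text \<open>Dividing by the norm finishes the construction. The mean is controlled only through its
  square, so accuracy \<epsilon>^2 is requested there and \<epsilon> for the form.\<close>

lemma concentrating_unit_functions:
  assumes no_gap: "\<And>\<eta>. \<eta> > 0 \<Longrightarrow> \<exists>f\<in>L2 M. \<eta> * (L2_inner M f f - (expectation f)\<^sup>2) > form f"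
    and "\<epsilon> > 0"
  obtains f where "f \<in> L2 M" "\<And>x. f x \<ge> 0" "L2_inner M f f = 1" "form f \<le> \<epsilon>" "expectation f \<le> \<epsilon>"
proof -
  have "min \<epsilon> (\<epsilon>\<^sup>2) > 0" using \<open>\<epsilon> > 0\<close> by simp
  from concentrating_functions[OF no_gap this] obtain f where f: "f \<in> L2 M" "\<forall>x. f x \<ge> 0"
    and V: "0 < L2_inner M f f" and ff: "form f \<le> min \<epsilon> (\<epsilon>\<^sup>2) * L2_inner M f f"
    and Ef: "(expectation f)\<^sup>2 \<le> min \<epsilon> (\<epsilon>\<^sup>2) * L2_inner M f f" by blast
  define n where "n = L2_norm M f"
  have n: "n > 0" "n\<^sup>2 = L2_inner M f f" using V by (auto simp: n_def L2_norm_square L2_norm_def)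
  let ?h = "\<lambda>x. (1 / n) * f x"
  have "form f \<le> \<epsilon> * n\<^sup>2" using ff mult_right_mono[of "min \<epsilon> (\<epsilon>\<^sup>2)" \<epsilon> "n\<^sup>2"] n zero_le_power2[of n] by simp
  then have 1: "form ?h \<le> \<epsilon>" unfolding form_cmult[OF f(1)] using n(1) by (simp add: field_simps)
  have "(expectation f)\<^sup>2 \<le> (\<epsilon> * n)\<^sup>2"
    using Ef mult_right_mono[of "min \<epsilon> (\<epsilon>\<^sup>2)" "\<epsilon>\<^sup>2" "n\<^sup>2"] n zero_le_power2[of n]
    by (simp add: power_mult_distrib)
  then have "expectation f \<le> \<epsilon> * n" by (rule power2_le_imp_le) (use n(1) \<open>\<epsilon> > 0\<close> in auto)
  then have 2: "expectation ?h \<le> \<epsilon>" using n(1) by (simp add: field_simps)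
  have 3: "L2_inner M ?h ?h = 1"
    unfolding L2_inner_cmult_left L2_inner_cmult_right using n V by (simp add: power2_eq_square)
  show ?thesis by (rule that[OF L2_cmult[OF f(1)] _ 3 1 2]) (use f(2) n(1) in auto)
qed

end

section \<open>Tail norms\<close>

text \<open>Common treatment of both tail norms. \<open>Lim\<close> and \<open>Sup\<close> are
  total, so convergence and boundedness must be established: \<open>le1\<close> bounds the sets, and
  \<open>dom\<close> makes the supremum decreasing in the cut-off, so the limit is the infimum. The
  predicate \<open>C\<close> stands for nonnegativity, letting upper bounds be checked on
  nonnegative functions alone.\<close>

lemma Lim_Sup_at_top:
  fixes V :: "real \<Rightarrow> 'b \<Rightarrow> real" and B C :: "'b \<Rightarrow> bool"
  defines "N \<equiv> Lim at_top (\<lambda>R. Sup {V R f | f. B f})"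
  assumes z: "B z" "\<And>R. 0 \<le> R \<Longrightarrow> 0 \<le> V R z"
    and le1: "\<And>R f. 0 \<le> R \<Longrightarrow> B f \<Longrightarrow> V R f \<le> 1"
    and dom: "\<And>R S f. 0 \<le> R \<Longrightarrow> R \<le> S \<Longrightarrow> B f \<Longrightarrow> \<exists>g. B g \<and> C g \<and> V S f \<le> V R g"
  shows "0 \<le> N"
    and "(\<And>R f. R0 \<le> R \<Longrightarrow> B f \<Longrightarrow> C f \<Longrightarrow> V R f \<le> b) \<Longrightarrow> N \<le> b"
    and "(\<And>R e. 0 \<le> R \<Longrightarrow> 0 < e \<Longrightarrow> \<exists>f. B f \<and> b - e \<le> V R f) \<Longrightarrow> b \<le> N"
proof -
  define T where "T R = Sup {V R f | f. B f}" for R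
  have bdd: "bdd_above {V R f | f. B f}" if "0 \<le> R" for R
    by (rule bdd_aboveI[of _ 1]) (use le1[OF that] in auto)
  have upper: "V R f \<le> T R" if "0 \<le> R" "B f" for R f
    unfolding T_def by (rule cSup_upper[OF _ bdd]) (use that in auto)
  have least: "T R \<le> c" if "\<And>f. B f \<Longrightarrow> V R f \<le> c" for R c
    unfolding T_def by (rule cSup_least) (use that z in auto)
  have mono: "T S \<le> T R" if RS: "0 \<le> R" "R \<le> S" for R S
  proof (rule least)
    fix f assume "B f"
    then obtain g where "B g" "V S f \<le> V R g" using dom[OF RS] by blast
    then show "V S f \<le> T R" using upper[OF RS(1)] by force
  qed
  have T0: "0 \<le> T R" if "0 \<le> R" for R using z(2)[OF that] upper[OF that z(1)] by linarith
  define L where "L = Inf (T ` {0..})"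
  have bdd': "bdd_below (T ` {0..})" by (rule bdd_belowI[of _ 0]) (use T0 in auto)
  have L_le: "L \<le> T R" if "0 \<le> R" for R
    unfolding L_def by (rule cInf_lower[OF _ bdd']) (use that in auto)
  have "(T \<longlongrightarrow> L) at_top"
  proof (rule decreasing_tendsto)
    show "eventually (\<lambda>R. L \<le> T R) at_top"
      using eventually_ge_at_top[of 0] by eventually_elim (rule L_le)
    fix x assume "L < x"
    then obtain R where R: "0 \<le> R" "T R < x"
      using bdd' by (auto simp: L_def cInf_less_iff)
    show "eventually (\<lambda>R. T R < x) at_top"
      using eventually_ge_at_top[of R] by eventually_elim (use mono R in force)
  qed
  then have N: "N = L" unfolding N_def T_def[symmetric] by (intro tendsto_Lim) auto
  have L_ge: "c \<le> L" if "\<And>R. 0 \<le> R \<Longrightarrow> c \<le> T R" for c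
    unfolding L_def by (rule cInf_greatest) (use that in auto)
  show "0 \<le> N" unfolding N using T0 by (rule L_ge)
  show "N \<le> b" if bound: "\<And>R f. R0 \<le> R \<Longrightarrow> B f \<Longrightarrow> C f \<Longrightarrow> V R f \<le> b"
  proof -
    let ?R = "max R0 0"
    have "T ?R \<le> b"
    proof (rule least)
      fix f assume "B f"
      \<comment> \<open>Domination at equal cut-offs trades \<open>f\<close> for a test function
        satisfying \<open>C\<close>.\<close>
      then obtain g where "B g" "C g" "V ?R f \<le> V ?R g" using dom[of ?R ?R f] by auto
      then show "V ?R f \<le> b" using bound[of ?R g] by force
    qed
    then show ?thesis unfolding N using L_le[of ?R] by simp
  qed
  show "b \<le> N" if approx: "\<And>R e. 0 \<le> R \<Longrightarrow> 0 < e \<Longrightarrow> \<exists>f. B f \<and> b - e \<le> V R f"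
    unfolding N
  proof (rule L_ge, rule field_le_epsilon)
    fix R e :: real assume "0 \<le> R" "0 < e"
    then obtain f where "B f" "b - e \<le> V R f" using approx by blast
    then show "b \<le> T R + e" using upper[OF \<open>0 \<le> R\<close>, of f] by linarith
  qed
qed

section \<open>The two tail norms of a Markov operator and of its powers\<close>

context markov_L2
begin

abbreviation unit_ball :: "('a \<Rightarrow> real) \<Rightarrow> bool" where
  "unit_ball f \<equiv> f \<in> L2 M \<and> expectation (\<lambda>x. (f x)\<^sup>2) \<le> 1"

lemma pos_part_L2:
  assumes "f \<in> L2 M"
  shows "(\<lambda>x. pos_part (f x - R)) \<in> L2 M"
  unfolding pos_part_def by (intro L2_max_0 L2_diff assms L2_const)

lemma unit_ball_norm: "unit_ball f \<Longrightarrow> L2_norm M f \<le> 1"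
  by (simp add: L2_norm_def L2_inner_self)

lemma unit_ball_P_norm: "unit_ball f \<Longrightarrow> L2_norm M (P f) \<le> 1"
  using P_contraction[of f] unit_ball_norm[of f] by linarith

lemma unit_ball_zero: "unit_ball (\<lambda>_. 0)"
  by (simp add: L2_const)

lemma tau_le_1:
  assumes "0 \<le> R" "unit_ball f"
  shows "expectation (\<lambda>x. f x * pos_part (P f x - R)) \<le> 1"
proof -
  have f: "f \<in> L2 M" using assms by simp
  have "L2_inner M f (\<lambda>x. pos_part (P f x - R)) \<le> L2_norm M f * L2_norm M (\<lambda>x. pos_part (P f x - R))"
    using L2_Cauchy_Schwarz[OF f pos_part_L2[OF P_L2[OF f], of R]] by linarith
  also have "L2_norm M (\<lambda>x. pos_part (P f x - R)) \<le> L2_norm M (P f)"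
    using \<open>0 \<le> R\<close> by (intro L2_norm_mono pos_part_L2 P_L2 f) (auto simp: pos_part_def)
  also have "L2_norm M f * L2_norm M (P f) \<le> 1 * 1"
    by (intro mult_mono unit_ball_norm unit_ball_P_norm assms L2_norm_nonneg) auto
  finally show ?thesis by (simp add: L2_inner_def mult_left_mono L2_norm_nonneg)
qed

text \<open>The second factor is nonnegative, so passing to the positive part of \<open>f\<close>
  increases both factors, and lowering the cut-off increases the second again.\<close>

lemma tau_dominated:
  assumes "R \<le> S" "unit_ball f"
  shows "\<exists>g. unit_ball g \<and> (\<forall>x. 0 \<le> g x) \<and>
    expectation (\<lambda>x. f x * pos_part (P f x - S)) \<le> expectation (\<lambda>x. g x * pos_part (P g x - R))"
proof (intro exI conjI)
  let ?g = "\<lambda>x. max (f x) 0"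
  have f: "f \<in> L2 M" using assms by simp
  note g = L2_max_0[OF f]
  show "?g \<in> L2 M" by (rule g)
  have "expectation (\<lambda>x. (?g x)\<^sup>2) \<le> expectation (\<lambda>x. (f x)\<^sup>2)"
    by (intro integral_mono L2_integrable_square f g) (auto simp: max_def)
  then show "expectation (\<lambda>x. (?g x)\<^sup>2) \<le> 1" using assms by simp
  show "\<forall>x. 0 \<le> ?g x" by simp
  have "AE x in M. P f x \<le> P ?g x" by (intro P_mono f g) auto
  then have "AE x in M. f x * pos_part (P f x - S) \<le> ?g x * pos_part (P ?g x - R)"
  proof eventually_elim
    case (elim x)
    have "f x * pos_part (P f x - S) \<le> ?g x * pos_part (P f x - S)"
      by (intro mult_right_mono) (auto simp: pos_part_def)
    also have "\<dots> \<le> ?g x * pos_part (P ?g x - R)"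
      using elim \<open>R \<le> S\<close> by (intro mult_left_mono) (auto simp: pos_part_def)
    finally show ?case .
  qed
  then show "expectation (\<lambda>x. f x * pos_part (P f x - S))
      \<le> expectation (\<lambda>x. ?g x * pos_part (P ?g x - R))"
    by (intro integral_mono_AE L2_mult_integrable pos_part_L2 P_L2 f g)
qed

lemma sqrt_tail_eq_norm:
  "sqrt (expectation (\<lambda>x. (pos_part (\<bar>P f x\<bar> - R))\<^sup>2)) = L2_norm M (\<lambda>x. pos_part (\<bar>P f x\<bar> - R))"
  by (simp add: L2_norm_def L2_inner_self)

lemma tail_le_1:
  assumes "0 \<le> R" "unit_ball f"
  shows "L2_norm M (\<lambda>x. pos_part (\<bar>P f x\<bar> - R)) \<le> 1"
proof -
  have "L2_norm M (\<lambda>x. pos_part (\<bar>P f x\<bar> - R)) \<le> L2_norm M (P f)"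
    using assms by (intro L2_norm_mono pos_part_L2 L2_abs P_L2) (auto simp: pos_part_def)
  then show ?thesis using unit_ball_P_norm[OF assms(2)] by linarith
qed

lemma tail_dominated:
  assumes "R \<le> S" "unit_ball f"
  shows "\<exists>g. unit_ball g \<and> (\<forall>x. 0 \<le> g x) \<and>
    L2_norm M (\<lambda>x. pos_part (\<bar>P f x\<bar> - S)) \<le> L2_norm M (\<lambda>x. pos_part (\<bar>P g x\<bar> - R))"
proof (intro exI conjI)
  let ?g = "\<lambda>x. \<bar>f x\<bar>"
  have f: "f \<in> L2 M" using assms by simp
  note g = L2_abs[OF f]
  show "?g \<in> L2 M" by (rule g)
  show "expectation (\<lambda>x. (?g x)\<^sup>2) \<le> 1" using assms by simp
  show "\<forall>x. 0 \<le> ?g x" by simp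
  show "L2_norm M (\<lambda>x. pos_part (\<bar>P f x\<bar> - S)) \<le> L2_norm M (\<lambda>x. pos_part (\<bar>P ?g x\<bar> - R))"
  proof (intro L2_norm_mono pos_part_L2 L2_abs P_L2 f g)
    show "AE x in M. \<bar>pos_part (\<bar>P f x\<bar> - S)\<bar> \<le> \<bar>pos_part (\<bar>P ?g x\<bar> - R)\<bar>"
      using P_abs[OF f] by eventually_elim (use \<open>R \<le> S\<close> in \<open>auto simp: pos_part_def\<close>)
  qed
qed

lemmas tau_norm_bounds =
  Lim_Sup_at_top[where V = "\<lambda>R f. expectation (\<lambda>x. f x * pos_part (P f x - R))" and B = unit_ball
    and C = "\<lambda>f. \<forall>x. 0 \<le> f x" and z = "\<lambda>_. 0", folded tau_norm_def,
    OF unit_ball_zero _ tau_le_1 tau_dominated, simplified]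

lemma tail_norm_eq:
  "tail_norm M P = Lim at_top (\<lambda>R. Sup {L2_norm M (\<lambda>x. pos_part (\<bar>P f x\<bar> - R)) | f. unit_ball f})"
  by (simp only: tail_norm_def sqrt_tail_eq_norm)

lemmas tail_norm_bounds =
  Lim_Sup_at_top[where V = "\<lambda>R f. L2_norm M (\<lambda>x. pos_part (\<bar>P f x\<bar> - R))" and B = unit_ball
    and C = "\<lambda>f. \<forall>x. 0 \<le> f x" and z = "\<lambda>_. 0", folded tail_norm_eq,
    OF unit_ball_zero L2_norm_nonneg tail_le_1 tail_dominated, simplified]

text \<open>For nonnegative \<open>f\<close> the cut-off costs at most R times the mean: <f, P f -
  R> is close to 1, and replacing the second factor by its positive part only helps. The tail norm
  follows by Cauchy-Schwarz, since \<open>f\<close> has norm 1.\<close>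

lemma norms_ge_1:
  assumes conc: "\<And>e. e > 0 \<Longrightarrow> \<exists>f\<in>L2 M. (\<forall>x. 0 \<le> f x) \<and> L2_inner M f f = 1 \<and>
    expectation f \<le> e \<and> 1 - e \<le> L2_inner M f (P f)"
  shows "1 \<le> tau_norm M P" "1 \<le> tail_norm M P"
proof -
  have key: "\<exists>f. unit_ball f \<and> 1 - e \<le> expectation (\<lambda>x. f x * pos_part (P f x - R)) \<and>
      1 - e \<le> L2_norm M (\<lambda>x. pos_part (\<bar>P f x\<bar> - R))" if "0 \<le> R" "0 < e" for R e
  proof -
    \<comment> \<open>The loss is \<open>d\<close> from the inner product and R * d from the mean,
      in total \<open>e\<close>.\<close>
    define d where "d = e / (R + 1)"
    have "d * (R + 1) = e" using that by (simp add: d_def)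
    then have d: "d + R * d = e" by (simp add: algebra_simps)
    have "d > 0" using that by (simp add: d_def)
    obtain f where f: "f \<in> L2 M" and f0: "\<forall>x. 0 \<le> f x" and f1: "L2_inner M f f = 1"
      and Ef: "expectation f \<le> d" and Pf: "1 - d \<le> L2_inner M f (P f)"
      using conc[OF \<open>d > 0\<close>] by blast
    note Pf2 = P_L2[OF f]
    have "1 - e \<le> L2_inner M f (P f) - R * expectation f"
      using mult_left_mono[OF Ef \<open>0 \<le> R\<close>] Pf d by linarith
    also have "\<dots> = L2_inner M f (\<lambda>x. P f x - R)"
      unfolding L2_inner_diff_right[OF Pf2 L2_const f] using L2_inner_cmult_right[of M f R "\<lambda>_. 1"]
      by (simp add: L2_inner_1)
    finally have low: "1 - e \<le> L2_inner M f (\<lambda>x. P f x - R)" .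
    also have "\<dots> \<le> L2_inner M f (\<lambda>x. pos_part (P f x - R))"
      using f0 by (intro L2_inner_mono f L2_diff Pf2 L2_const pos_part_L2 AE_I2)
        (auto intro!: mult_left_mono simp: pos_part_def)
    finally have 1: "1 - e \<le> expectation (\<lambda>x. f x * pos_part (P f x - R))" by (simp add: L2_inner_def)
    note low
    also have "L2_inner M f (\<lambda>x. P f x - R) \<le> L2_inner M f (\<lambda>x. pos_part (\<bar>P f x\<bar> - R))"
      using f0 by (intro L2_inner_mono f L2_diff Pf2 L2_const pos_part_L2 L2_abs AE_I2)
        (auto intro!: mult_left_mono simp: pos_part_def)
    also have "\<dots> \<le> L2_norm M f * L2_norm M (\<lambda>x. pos_part (\<bar>P f x\<bar> - R))"
      using L2_Cauchy_Schwarz[OF f pos_part_L2[OF L2_abs[OF Pf2], of R]] by linarith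
    also have "\<dots> = L2_norm M (\<lambda>x. pos_part (\<bar>P f x\<bar> - R))"
      using f1 by (simp add: L2_norm_def[of M f])
    finally show ?thesis using 1 f f1 by (auto simp: L2_inner_self)
  qed
  show "1 \<le> tau_norm M P" by (rule tau_norm_bounds(3)) (use key in blast)
  show "1 \<le> tail_norm M P" by (rule tail_norm_bounds(3)) (use key in blast)
qed

lemma funpow_markov: "markov_operator M (P ^^ k)" "invariant_measure M (P ^^ k)"
proof (induction k)
  case 0
  show "markov_operator M (P ^^ 0)" "invariant_measure M (P ^^ 0)"
    by (auto simp: markov_operator_def invariant_measure_def)
next
  case (Suc k)
  interpret Pk: markov_L2 M "P ^^ k" by unfold_locales (rule Suc)+
  show "invariant_measure M (P ^^ Suc k)"
    by (simp add: invariant_measure_def expectation_P Pk.expectation_P Pk.P_L2)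
  show "markov_operator M (P ^^ Suc k)"
    unfolding markov_operator_def
  proof (intro conjI ballI impI allI)
    fix f assume f: "f \<in> L2 M"
    show "(P ^^ Suc k) f \<in> L2 M" using f by (simp add: P_L2 Pk.P_L2)
    show "AE x in M. 0 \<le> (P ^^ Suc k) f x" if "AE x in M. 0 \<le> f x"
      using P_nonneg[OF Pk.P_L2[OF f] Pk.P_nonneg[OF f that]] by simp
    fix g assume g: "g \<in> L2 M"
    show "AE x in M. (P ^^ Suc k) f x = (P ^^ Suc k) g x" if "AE x in M. f x = g x"
      using P_cong_AE[OF Pk.P_L2[OF f] Pk.P_L2[OF g] Pk.P_cong_AE[OF f g that]] by simp
    fix a b
    have "AE x in M. P ((P ^^ k) (\<lambda>y. a * f y + b * g y)) x
        = P (\<lambda>x. a * (P ^^ k) f x + b * (P ^^ k) g x) x"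
      by (intro P_cong_AE Pk.P_L2 L2_lincomb f g Pk.P_lincomb)
    then show "AE x in M. (P ^^ Suc k) (\<lambda>y. a * f y + b * g y) x
        = a * (P ^^ Suc k) f x + b * (P ^^ Suc k) g x"
      using P_lincomb[OF Pk.P_L2[OF f] Pk.P_L2[OF g], of a b] by auto
  next
    show "AE x in M. (P ^^ Suc k) (\<lambda>_. 1) x = 1"
      using P_cong_AE[OF Pk.P_L2[OF L2_const] L2_const Pk.P_1] P_1 by auto
  qed
qed

lemma funpow_markov_L2: "markov_L2 M (P ^^ k)"
  by unfold_locales (rule funpow_markov)+

lemma funpow_L2: "f \<in> L2 M \<Longrightarrow> (P ^^ k) f \<in> L2 M"
  using markov_L2.P_L2[OF funpow_markov_L2] .

text \<open>Telescoping: \<open>(P ^^ Suc k) f - f\<close> is \<open>P\<close> applied to the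
  previous difference plus \<open>P f - f\<close>, and \<open>P\<close> is a contraction.\<close>

lemma norm_funpow_diff_le:
  assumes f: "f \<in> L2 M"
  shows "L2_norm M (\<lambda>x. (P ^^ k) f x - f x) \<le> real k * L2_norm M (\<lambda>x. P f x - f x)"
proof (induction k)
  case 0
  show ?case by (simp add: L2_norm_def L2_inner_def)
next
  case (Suc k)
  note Pk = funpow_L2[OF f, of k]
  note d = L2_diff[OF Pk f]
  have "L2_norm M (\<lambda>x. (P ^^ Suc k) f x - f x)
      = L2_norm M (\<lambda>x. P (\<lambda>x. (P ^^ k) f x - f x) x + (P f x - f x))"
    using P_diff[OF Pk f]
    by (intro L2_norm_cong_AE L2_diff L2_add P_L2 d f funpow_L2) (auto simp: Pk)
  also have "\<dots> \<le> L2_norm M (P (\<lambda>x. (P ^^ k) f x - f x)) + L2_norm M (\<lambda>x. P f x - f x)"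
    by (intro L2_norm_triangle P_L2 L2_diff Pk f)
  also have "\<dots> \<le> real k * L2_norm M (\<lambda>x. P f x - f x) + L2_norm M (\<lambda>x. P f x - f x)"
    using P_contraction[OF d] Suc by linarith
  finally show ?case by (simp add: algebra_simps)
qed

text \<open>Almost invariance is required for \<open>P\<close> only, so one family of functions
  serves all powers at once.\<close>

lemma funpow_norms_ge_1:
  assumes conc: "\<And>e. e > 0 \<Longrightarrow> \<exists>f\<in>L2 M. (\<forall>x. 0 \<le> f x) \<and> L2_inner M f f = 1 \<and>
    form f \<le> e \<and> expectation f \<le> e"
  shows "1 \<le> tau_norm M (P ^^ k)" "1 \<le> tail_norm M (P ^^ k)"
proof -
  have "\<exists>f\<in>L2 M. (\<forall>x. 0 \<le> f x) \<and> L2_inner M f f = 1 \<and>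
    expectation f \<le> e \<and> 1 - e \<le> L2_inner M f ((P ^^ k) f)" if "e > 0" for e
  proof -
    \<comment> \<open>Inverts norm^2 \<le> 2 * form, so that \<open>k\<close> steps move
      \<open>f\<close> by at most \<open>e\<close>; \<open>Suc k\<close> keeps the quotient
      meaningful for k = 0.\<close>
    define d where "d = min e ((e / real (Suc k))\<^sup>2 / 2)"
    have "d > 0" using \<open>e > 0\<close> by (simp add: d_def)
    then obtain f where f: "f \<in> L2 M" and f0: "\<forall>x. 0 \<le> f x" and f1: "L2_inner M f f = 1"
      and ff: "form f \<le> d" and Ef: "expectation f \<le> d" using conc by blast
    have "(L2_norm M (\<lambda>x. P f x - f x))\<^sup>2 \<le> (e / real (Suc k))\<^sup>2"
      using norm_P_diff_le_form[OF f] ff unfolding d_def by linarith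
    then have P1: "L2_norm M (\<lambda>x. P f x - f x) \<le> e / real (Suc k)"
      by (rule power2_le_imp_le) (use \<open>e > 0\<close> in simp)
    have "L2_norm M (\<lambda>x. (P ^^ k) f x - f x) \<le> real k * (e / real (Suc k))"
      using norm_funpow_diff_le[OF f, of k] mult_left_mono[OF P1, of "real k"] by simp
    also have "\<dots> \<le> e" using \<open>e > 0\<close> by (simp add: field_simps)
    finally have "L2_norm M (\<lambda>x. (P ^^ k) f x - f x) \<le> e" .
    moreover have "\<bar>L2_inner M f (\<lambda>x. (P ^^ k) f x - f x)\<bar> \<le> L2_norm M f * L2_norm M (\<lambda>x. (P ^^ k) f x - f x)"
      by (intro L2_Cauchy_Schwarz f L2_diff funpow_L2)
    moreover have "L2_norm M f = 1" using f1 by (simp add: L2_norm_def)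
    ultimately have "\<bar>L2_inner M f (\<lambda>x. (P ^^ k) f x - f x)\<bar> \<le> e" by simp
    then have "1 - e \<le> L2_inner M f ((P ^^ k) f)"
      using L2_inner_diff_right[OF funpow_L2[OF f, of k] f f] f1 by linarith
    then show ?thesis using f f0 f1 Ef by (auto simp: d_def)
  qed
  then show "1 \<le> tau_norm M (P ^^ k)" "1 \<le> tail_norm M (P ^^ k)"
    using markov_L2.norms_ge_1[OF funpow_markov_L2, of k] by blast+
qed

text \<open>Splitting \<open>f = min f S + g\<close>, only \<open>g\<close> survives the cut-off at large \<open>R\<close>, and
  the Poincare inequality applies to \<open>g\<close>, whose mean is at most \<open>1 / S\<close>.\<close>

lemma Poincare_imp_tau_norm_less_1:
  assumes \<theta>: "-1 \<le> \<theta>" "\<theta> < 1"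
    and Poincare: "\<And>f. f \<in> L2 M \<Longrightarrow> L2_inner M f f \<le> 1 / (1 - \<theta>) * form f + (expectation f)\<^sup>2"
  shows "tau_norm M P < 1"
proof -
  \<comment> \<open>A negative \<theta> would make the bound on \<theta> times the square norm
    useless when that norm is small, hence the maximum with 0.\<close>
  define t where "t = max \<theta> 0"
  define \<eta> where "\<eta> = (1 - t) / 2"
  have \<eta>: "\<eta> > 0" "t + \<eta> < 1" using \<theta> by (auto simp: t_def \<eta>_def max_def field_simps)
  \<comment> \<open>The mean of the excess over \<open>S\<close> is at most 1 / S, and 1 - \<theta>
    \<le> 2, so the mean term costs 2 / S^2 = \<eta> / 2.\<close>
  define S where "S = 2 / sqrt \<eta>"
  have S: "S > 0" "2 * (1 / S)\<^sup>2 = \<eta> / 2" using \<eta> by (auto simp: S_def power_divide)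
  have "tau_norm M P \<le> t + \<eta>"
  proof (rule tau_norm_bounds(2))
    fix R f assume R: "S + 2 * S / \<eta> \<le> R" and fB: "unit_ball f" and f0: "\<forall>x. 0 \<le> f x"
    have "2 * S / \<eta> > 0" using S \<eta> by simp
    with R have RS1: "R - S > 0" by linarith
    have "2 * S / \<eta> \<le> R - S" using R by linarith
    then have "2 * S \<le> (R - S) * \<eta>" using \<eta>(1) by (simp add: pos_divide_le_eq)
    then have "S / (R - S) \<le> \<eta> / 2" using RS1 by (simp add: pos_divide_le_eq mult.commute)
    with RS1 have RS: "R - S > 0" "S / (R - S) \<le> \<eta> / 2" by auto
    let ?g = "\<lambda>x. max (f x - S) 0"
    have f: "f \<in> L2 M" and f1: "L2_inner M f f \<le> 1" using fB by (auto simp: L2_inner_self)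
    have g: "?g \<in> L2 M" by (intro L2_max_0 L2_diff f L2_const)
    note Pg = P_L2[OF g]
    have g_le_f: "L2_inner M ?g ?g \<le> L2_inner M f f"
      using f0 S(1) by (intro L2_inner_mono f g AE_I2) (auto intro!: mult_mono)
    have Pgg: "L2_inner M (P ?g) (P ?g) \<le> 1" using P_contraction_inner[OF g] g_le_f f1 by linarith
    have Eg: "expectation ?g \<le> 1 / S"
    proof -
      have "expectation ?g \<le> expectation (\<lambda>x. (1 / S) * (f x)\<^sup>2)"
      proof (rule integral_mono)
        fix x
        have "S * f x \<le> S * S + f x * f x"
          using sum_squares_bound[of S "f x"] mult_nonneg_nonneg[OF less_imp_le[OF S(1)], of "f x"] f0
          unfolding power2_eq_square mult.assoc by (smt (verit))
        then show "?g x \<le> (1 / S) * (f x)\<^sup>2"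
          using S(1) by (simp add: divide_simps power2_eq_square algebra_simps max_def)
      qed (use L2_integrable[OF g] L2_integrable_square[OF f] in auto)
      also have "\<dots> = (1 / S) * L2_inner M f f" by (simp add: L2_inner_self)
      also have "\<dots> \<le> (1 / S) * 1" using S(1) by (intro mult_left_mono f1) auto
      finally show ?thesis by simp
    qed
    have "(1 - \<theta>) * L2_inner M ?g ?g \<le> form ?g + (1 - \<theta>) * (expectation ?g)\<^sup>2"
      using mult_left_mono[OF Poincare[OF g], of "1 - \<theta>"] \<theta> by (simp add: distrib_left)
    then have "L2_inner M ?g (P ?g) \<le> \<theta> * L2_inner M ?g ?g + (1 - \<theta>) * (expectation ?g)\<^sup>2"
      by (simp add: form_def algebra_simps)
    also have "\<dots> \<le> t * 1 + 2 * (1 / S)\<^sup>2"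
    proof (rule add_mono)
      have "\<theta> * L2_inner M ?g ?g \<le> t * L2_inner M ?g ?g"
        by (intro mult_right_mono L2_inner_self_nonneg) (simp add: t_def)
      also have "\<dots> \<le> t * 1" using g_le_f f1 by (intro mult_left_mono) (auto simp: t_def)
      finally show "\<theta> * L2_inner M ?g ?g \<le> t * 1" .
      show "(1 - \<theta>) * (expectation ?g)\<^sup>2 \<le> 2 * (1 / S)\<^sup>2"
        using \<theta> Eg by (intro mult_mono power_mono) auto
    qed
    finally have gPg: "L2_inner M ?g (P ?g) \<le> t + \<eta> / 2" using S(2) by simp
    have "AE x in M. P f x \<le> P (\<lambda>x. ?g x + S) x"
      by (intro P_mono f L2_add g L2_const) auto
    moreover have "AE x in M. 0 \<le> P ?g x" by (intro P_nonneg g) auto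
    ultimately have "AE x in M. f x * pos_part (P f x - R) \<le> ?g x * P ?g x + S / (R - S) * (P ?g x * P ?g x)"
      using P_add_const[OF g, of S]
    proof eventually_elim
      case (elim x)
      \<comment> \<open>Both f \<le> ?g + S and P f \<le> P ?g + S hold, leaving the cut-off R - S
        for P ?g. The part \<open>S * ?p\<close> is paid by ?p \<le> (P ?g)^2 / (R - S), small for
        large \<open>R\<close>.\<close>
      let ?p = "pos_part (P ?g x - (R - S))"
      have p: "0 \<le> ?p" "?p \<le> P ?g x" using elim RS(1) by (auto simp: pos_part_def)
      have "(R - S) * P ?g x \<le> (R - S) * (R - S) + P ?g x * P ?g x"
        using sum_squares_bound[of "R - S" "P ?g x"] mult_nonneg_nonneg[OF less_imp_le[OF RS(1)] elim(2)]
        unfolding power2_eq_square mult.assoc by linarith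
      then have p2: "?p \<le> 1 / (R - S) * (P ?g x * P ?g x)"
        using RS(1) by (simp add: pos_part_def max_def divide_simps) (simp add: algebra_simps)
      have "f x * pos_part (P f x - R) \<le> (?g x + S) * ?p"
        using elim f0 p S(1) by (intro mult_mono) (auto simp: pos_part_def)
      also have "\<dots> = ?g x * ?p + S * ?p" by (simp add: distrib_right)
      also have "\<dots> \<le> ?g x * P ?g x + S * (1 / (R - S) * (P ?g x * P ?g x))"
        using p p2 S(1) by (intro add_mono mult_left_mono) auto
      finally show ?case by simp
    qed
    then have "expectation (\<lambda>x. f x * pos_part (P f x - R))
        \<le> expectation (\<lambda>x. ?g x * P ?g x + S / (R - S) * (P ?g x * P ?g x))"
      by (intro integral_mono_AE Bochner_Integration.integrable_add integrable_mult_right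
          L2_mult_integrable pos_part_L2 P_L2 f g)
    also have "\<dots> = L2_inner M ?g (P ?g) + S / (R - S) * L2_inner M (P ?g) (P ?g)"
      unfolding L2_inner_def using L2_mult_integrable[OF g Pg] L2_mult_integrable[OF Pg Pg] by simp
    also have "\<dots> \<le> (t + \<eta> / 2) + (\<eta> / 2) * 1"
      using RS S(1) \<eta> by (intro add_mono gPg mult_mono Pgg L2_inner_self_nonneg) auto
    finally show "expectation (\<lambda>x. f x * pos_part (P f x - R)) \<le> t + \<eta>" by simp
  qed
  then show ?thesis using \<eta>(2) by linarith
qed

text \<open>If \<open>f \<ge> 0\<close> nearly attains tail norm one, then \<open>P (P f)\<close> is close to \<open>f\<close>, so
  \<open>f + P f\<close> is nearly invariant; it has small mean, contradicting the Poincare inequality.\<close>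

lemma Poincare_imp_tail_norm_less_1:
  assumes sym: "\<And>f g. f \<in> L2 M \<Longrightarrow> g \<in> L2 M \<Longrightarrow> L2_inner M g (P f) = L2_inner M (P g) f"
    and "C > 0"
    and Poincare: "\<And>f. f \<in> L2 M \<Longrightarrow> L2_inner M f f \<le> C * form f + (expectation f)\<^sup>2"
  shows "tail_norm M P < 1"
proof -
  \<comment> \<open>The contradiction will read 1 < 2 * C * \<sigma> + 17 * \<sigma>^2, impossible
    because \<sigma>^2 \<le> \<sigma> and (2 * C + 18) * \<sigma> = 1.\<close>
  define \<sigma> where "\<sigma> = 1 / (2 * C + 18)"
  have \<sigma>: "0 < \<sigma>" "\<sigma> < 1" "(2 * C + 18) * \<sigma> = 1" using \<open>C > 0\<close> by (auto simp: \<sigma>_def field_simps)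
  have \<sigma>2: "0 < \<sigma>\<^sup>2" "\<sigma>\<^sup>2 \<le> \<sigma>" using \<sigma> by (auto simp: power2_eq_square mult_le_cancel_left1)
  define b where "b = sqrt (1 - \<sigma>\<^sup>2)"
  have b: "b < 1" "b\<^sup>2 = 1 - \<sigma>\<^sup>2" "0 \<le> b" using \<sigma> \<sigma>2 by (auto simp: b_def)
  have "tail_norm M P \<le> b"
  proof (rule tail_norm_bounds(2), rule ccontr)
    fix R f assume R: "1 / \<sigma> \<le> R" and fB: "unit_ball f" and f0: "\<forall>x. 0 \<le> f x"
      and "\<not> L2_norm M (\<lambda>x. pos_part (\<bar>P f x\<bar> - R)) \<le> b"
    have "1 / \<sigma> > 0" using \<sigma>(1) by simp
    with R have R0: "R > 0" by linarith
    have R1: "1 / R \<le> \<sigma>" using R R0 \<sigma>(1) by (simp add: field_simps)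
    have f: "f \<in> L2 M" and f1: "L2_inner M f f \<le> 1" using fB by (auto simp: L2_inner_self)
    define w where "w = P f"
    have w: "w \<in> L2 M" unfolding w_def by (rule P_L2[OF f])
    have w0: "AE x in M. 0 \<le> w x" unfolding w_def by (rule P_nonneg[OF f]) (use f0 in auto)
    have w1: "L2_inner M w w \<le> 1" unfolding w_def using P_contraction_inner[OF f] f1 by linarith
    let ?p = "\<lambda>x. pos_part (\<bar>w x\<bar> - R)"
    let ?m = "\<lambda>x. min \<bar>w x\<bar> R"
    have p: "?p \<in> L2 M" by (intro pos_part_L2 L2_abs w)
    have m: "?m \<in> L2 M"
      by (rule L2_dominated[OF w]) (use R0 L2_measurable[OF w] in auto)
    have "b < L2_norm M ?p" using \<open>\<not> _\<close> by (simp add: w_def)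
    then have "b\<^sup>2 < (L2_norm M ?p)\<^sup>2" using b(3) by (intro power_strict_mono) auto
    then have pp: "1 - \<sigma>\<^sup>2 < L2_inner M ?p ?p" by (simp add: L2_norm_square b(2))
    \<comment> \<open>Both pieces are nonnegative with sum |w|, so their square norms add up to at
      most that of \<open>w\<close>. Nearly all of it sits in ?p, so the bounded piece ?m is small
      in norm and hence in mean.\<close>
    have "L2_inner M ?m ?m + L2_inner M ?p ?p = expectation (\<lambda>x. ?m x * ?m x + ?p x * ?p x)"
      unfolding L2_inner_def using L2_mult_integrable[OF m m] L2_mult_integrable[OF p p] by simp
    also have "\<dots> \<le> L2_inner M w w"
      unfolding L2_inner_def
    proof (rule integral_mono)
      fix x
      have "?m x * ?m x + ?p x * ?p x \<le> (?m x + ?p x) * (?m x + ?p x)"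
        using R0 by (simp add: algebra_simps pos_part_def)
      also have "?m x + ?p x = \<bar>w x\<bar>" by (auto simp: pos_part_def)
      finally show "?m x * ?m x + ?p x * ?p x \<le> w x * w x" by simp
    qed (intro Bochner_Integration.integrable_add L2_mult_integrable m p w)+
    finally have mp: "L2_inner M ?m ?m + L2_inner M ?p ?p \<le> L2_inner M w w" .
    then have ww: "1 - \<sigma>\<^sup>2 < L2_inner M w w" using pp L2_inner_self_nonneg[of M ?m] by linarith
    have "(L2_norm M ?m)\<^sup>2 \<le> \<sigma>\<^sup>2" using mp pp w1 unfolding L2_norm_square by linarith
    then have "L2_norm M ?m \<le> \<sigma>" by (rule power2_le_imp_le) (use \<sigma>(1) in simp)
    then have Em: "expectation ?m \<le> \<sigma>"
      using expectation_abs_le_L2_norm[OF m] R0 by (simp add: abs_of_nonneg)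
    have Ep: "expectation ?p \<le> \<sigma>"
    proof -
      have "expectation ?p \<le> expectation (\<lambda>x. (1 / R) * (w x)\<^sup>2)"
      proof (rule integral_mono)
        fix x
        have "R * \<bar>w x\<bar> \<le> R * R + \<bar>w x\<bar> * \<bar>w x\<bar>"
          using sum_squares_bound[of R "\<bar>w x\<bar>"] mult_nonneg_nonneg[OF less_imp_le[OF R0] abs_ge_zero, of "w x"]
          unfolding power2_eq_square mult.assoc by linarith
        then show "?p x \<le> (1 / R) * (w x)\<^sup>2"
          using R0 by (simp add: pos_part_def divide_simps power2_eq_square algebra_simps max_def)
      qed (use L2_integrable[OF p] L2_integrable_square[OF w] in auto)
      also have "\<dots> = (1 / R) * L2_inner M w w" by (simp add: L2_inner_self)
      also have "\<dots> \<le> \<sigma> * 1" using R0 by (intro mult_mono R1 w1 L2_inner_self_nonneg) (use \<sigma> in auto)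
      finally show ?thesis by simp
    qed
    have "expectation w = expectation (\<lambda>x. ?m x + ?p x)"
      using w0 by (intro integral_cong_AE L2_measurable L2_add w m p) (auto simp: pos_part_def)
    also have "\<dots> = expectation ?m + expectation ?p"
      by (intro Bochner_Integration.integral_add L2_integrable m p)
    finally have Ew: "expectation w \<le> 2 * \<sigma>" using Em Ep by linarith
    have Efw: "expectation f = expectation w" unfolding w_def by (simp add: expectation_P[OF f])
    have Ew0: "0 \<le> expectation w" by (rule integral_nonneg_AE[OF w0])
    \<comment> \<open>As w = P f, the middle terms cancel in ?v - P ?v = f - P w. Thus closeness of
      \<open>f\<close> to its second image suffices, although \<open>f\<close> itself may be far
      from \<open>P f\<close>.\<close>
    let ?v = "\<lambda>x. f x + w x" and ?d = "\<lambda>x. f x - P w x"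
    note Pw = P_L2[OF w]
    have v: "?v \<in> L2 M" by (intro L2_add f w)
    have d: "?d \<in> L2 M" by (intro L2_diff f Pw)
    have "(L2_norm M ?d)\<^sup>2 = L2_inner M f f - 2 * L2_inner M f (P w) + L2_inner M (P w) (P w)"
      unfolding L2_norm_square L2_inner_diff_left[OF f Pw d]
        L2_inner_diff_right[OF f Pw f] L2_inner_diff_right[OF f Pw Pw] L2_inner_commute[of M "P w" f]
      by simp
    also have "L2_inner M f (P w) = L2_inner M w w" using sym[OF w f] by (simp add: w_def)
    finally have "(L2_norm M ?d)\<^sup>2 \<le> \<sigma>\<^sup>2"
      using f1 ww P_contraction_inner[OF w] by linarith
    then have d\<sigma>: "L2_norm M ?d \<le> \<sigma>" by (rule power2_le_imp_le) (use \<sigma>(1) in simp)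
    have v2: "L2_norm M ?v \<le> 2"
      using L2_norm_triangle[OF f w] unit_ball_norm[OF fB] unit_ball_P_norm[OF fB]
      unfolding w_def by linarith
    have "form ?v = L2_inner M ?v (\<lambda>x. ?v x - P ?v x)"
      unfolding form_def by (rule L2_inner_diff_right[symmetric, OF v P_L2[OF v] v])
    also have "\<dots> = L2_inner M ?v ?d"
      using P_add[OF f w] by (intro L2_inner_cong_AE v d L2_diff P_L2) (auto simp: w_def)
    also have "\<dots> \<le> L2_norm M ?v * L2_norm M ?d" using L2_Cauchy_Schwarz[OF v d] by linarith
    also have "\<dots> \<le> 2 * \<sigma>" using v2 d\<sigma> by (intro mult_mono L2_norm_nonneg) auto
    finally have fv: "form ?v \<le> 2 * \<sigma>" .
    have Ev: "expectation ?v = 2 * expectation w"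
      using L2_integrable[OF f] L2_integrable[OF w] Efw by simp
    have "(expectation ?v)\<^sup>2 \<le> (4 * \<sigma>)\<^sup>2"
      unfolding Ev using Ew Ew0 by (intro power_mono) auto
    then have Ev2: "(expectation ?v)\<^sup>2 \<le> 16 * \<sigma>\<^sup>2" by (simp add: power_mult_distrib)
    \<comment> \<open>Nonnegativity prevents cancellation in the sum, so ?v keeps nearly unit
      norm.\<close>
    have "L2_inner M w w \<le> L2_inner M ?v ?v"
    proof (intro L2_inner_mono v w)
      show "AE x in M. w x * w x \<le> ?v x * ?v x"
        using w0 by eventually_elim (use f0 in \<open>auto intro!: mult_mono\<close>)
    qed
    also have "\<dots> \<le> C * form ?v + (expectation ?v)\<^sup>2" by (rule Poincare[OF v])
    also have "\<dots> \<le> C * (2 * \<sigma>) + 16 * \<sigma>\<^sup>2" using fv Ev2 \<open>C > 0\<close> by (intro add_mono mult_left_mono) auto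
    finally have "1 < 2 * C * \<sigma> + 17 * \<sigma>\<^sup>2" using ww by simp
    then show False using \<sigma> \<sigma>2 by (simp add: algebra_simps)
  qed
  then show ?thesis using b(1) by linarith
qed

end

section \<open>The adjoint and the symmetrised operator as Markov operators\<close>

context ergodic_markov_L2
begin

text \<open>Test against the negative part \<open>?h\<close> of \<open>Pstar f\<close>: then 0 \<le>
  <f, P ?h> = <Pstar f, ?h> = -<?h, ?h>.\<close>

lemma Pstar_nonneg:
  assumes f: "f \<in> L2 M" and f0: "AE x in M. 0 \<le> f x"
  shows "AE x in M. 0 \<le> Pstar f x"
proof -
  let ?h = "\<lambda>x. max (- Pstar f x) 0"
  note Sf = Pstar_L2[OF f]
  have h: "?h \<in> L2 M" by (intro L2_max_0 L2_uminus Sf)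
  have "0 \<le> L2_inner M f (P ?h)" by (intro L2_inner_nonneg f0 P_nonneg h) auto
  also have "\<dots> = L2_inner M (Pstar f) ?h" by (rule Pstar_inner[OF h f])
  also have "\<dots> = - L2_inner M ?h ?h"
    unfolding L2_inner_def
    by (subst Bochner_Integration.integral_minus[symmetric], rule Bochner_Integration.integral_cong)
      (auto simp: max_def)
  finally have "L2_norm M ?h = 0"
    using L2_inner_self_nonneg[of M ?h] by (simp add: L2_norm_def)
  from L2_norm_eq_0_AE[OF h this] show ?thesis by eventually_elim (auto simp: max_def split: if_splits)
qed

lemma Pstar_cong_AE:
  assumes f: "f \<in> L2 M" and g: "g \<in> L2 M" and eq: "AE x in M. f x = g x"
  shows "AE x in M. Pstar f x = Pstar g x"
proof (rule L2_eqI_AE[OF Pstar_L2[OF f] Pstar_L2[OF g]])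
  fix h assume h: "h \<in> L2 M"
  show "L2_inner M (Pstar f) h = L2_inner M (Pstar g) h"
    unfolding Pstar_inner[OF h f, symmetric] Pstar_inner[OF h g, symmetric]
    by (intro L2_inner_cong_AE f g P_L2 h eq) auto
qed

lemma Pstar_1: "AE x in M. Pstar (\<lambda>_. 1) x = 1"
proof (rule L2_eqI_AE[OF Pstar_L2[OF L2_const] L2_const])
  fix h assume h: "h \<in> L2 M"
  show "L2_inner M (Pstar (\<lambda>_. 1)) h = L2_inner M (\<lambda>_. 1) h"
    unfolding Pstar_inner[OF h L2_const, symmetric]
    by (simp add: L2_inner_commute[of M "\<lambda>_. 1"] L2_inner_1 expectation_P[OF h])
qed

definition Phat :: "('a \<Rightarrow> real) \<Rightarrow> ('a \<Rightarrow> real)" where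
  "Phat = (\<lambda>f x. (P f x + Pstar f x) / 2)"

lemma Phat_eq: "Phat f = (\<lambda>x. (1/2) * P f x + (1/2) * Pstar f x)"
  by (auto simp: Phat_def)

lemma Phat_L2: "f \<in> L2 M \<Longrightarrow> Phat f \<in> L2 M"
  unfolding Phat_eq by (intro L2_lincomb P_L2 Pstar_L2)

lemma Phat_markov_L2: "markov_L2 M Phat"
proof unfold_locales
  show "markov_operator M Phat"
    unfolding markov_operator_def
  proof (intro conjI ballI impI allI)
    fix f assume f: "f \<in> L2 M"
    show "Phat f \<in> L2 M" by (rule Phat_L2[OF f])
    show "AE x in M. 0 \<le> Phat f x" if "AE x in M. 0 \<le> f x"
      using P_nonneg[OF f that] Pstar_nonneg[OF f that] by (auto simp: Phat_def)
    fix g assume g: "g \<in> L2 M"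
    show "AE x in M. Phat f x = Phat g x" if "AE x in M. f x = g x"
      using P_cong_AE[OF f g that] Pstar_cong_AE[OF f g that] by (auto simp: Phat_def)
    fix a b
    show "AE x in M. Phat (\<lambda>y. a * f y + b * g y) x = a * Phat f x + b * Phat g x"
      using P_lincomb[OF f g, of a b] Pstar_lincomb[OF f g, of a b]
      by eventually_elim (simp add: Phat_def field_simps)
  next
    show "AE x in M. Phat (\<lambda>_. 1) x = 1" using P_1 Pstar_1 by (auto simp: Phat_def)
  qed
  show "invariant_measure M Phat"
    unfolding invariant_measure_def
  proof
    fix f assume f: "f \<in> L2 M"
    show "expectation (Phat f) = expectation f"
      unfolding Phat_eq using L2_integrable[OF P_L2[OF f]] L2_integrable[OF Pstar_L2[OF f]]
      by (simp add: expectation_P[OF f] expectation_Pstar[OF f])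
  qed
qed

lemma Phat_symmetric:
  assumes f: "f \<in> L2 M" and g: "g \<in> L2 M"
  shows "L2_inner M g (Phat f) = L2_inner M (Phat g) f"
  unfolding Phat_eq L2_inner_lincomb_right[OF P_L2[OF f] Pstar_L2[OF f] g]
    L2_inner_lincomb_left[OF P_L2[OF g] Pstar_L2[OF g] f]
  using Pstar_inner[OF f g] Pstar_inner[OF g f]
  by (simp add: L2_inner_commute[of M "P g"] L2_inner_commute[of M g "Pstar f"])

text \<open><f, Pstar f> = <f, P f>, so both operators have the same Poincare inequality and the
  same almost invariant functions in the sense of the form.\<close>

lemma form_Phat:
  assumes f: "f \<in> L2 M"
  shows "markov_L2.form M Phat f = form f"
  unfolding form_def markov_L2.form_def[OF Phat_markov_L2] Phat_eq
    L2_inner_lincomb_right[OF P_L2[OF f] Pstar_L2[OF f] f]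
  using Pstar_inner[OF f f] by (simp add: L2_inner_commute[of M f "Pstar f"])

end

theorem theorem1p1:
  fixes M :: "'a measure"
    and P Pstar :: "('a \<Rightarrow> real) \<Rightarrow> ('a \<Rightarrow> real)"
  assumes "prob_space M"
    and "markov_operator M P"
    and "invariant_measure M P"
    and "ergodic_op M P"
    and "is_adjoint M P Pstar"
  defines "Phat \<equiv> (\<lambda>f x. (P f x + Pstar f x) / 2)"
  shows
    "((\<exists>\<theta>::real. -1 \<le> \<theta> \<and> \<theta> < 1 \<and>
        (\<forall>f\<in>L2 M. integral\<^sup>L M (\<lambda>x. (f x)\<^sup>2)
           \<le> 1 / (1 - \<theta>) * integral\<^sup>L M (\<lambda>x. f x * (f x - P f x)) + (integral\<^sup>L M f)\<^sup>2))
      \<longleftrightarrow> tau_norm M P < 1)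
     \<and> (tau_norm M P < 1 \<longleftrightarrow> (INF m\<in>{1::nat..}. tau_norm M (P ^^ (2 * m - 1))) < 1)
     \<and> (tau_norm M P < 1 \<longleftrightarrow> (INF m\<in>{1::nat..}. tail_norm M (Phat ^^ m)) < 1)"
proof -
  interpret prob_space M by fact
  interpret E: ergodic_markov_L2 M P Pstar by unfold_locales fact+
  have Phat: "Phat = E.Phat" by (simp add: Phat_def E.Phat_def)
  interpret H: markov_L2 M Phat unfolding Phat by (rule E.Phat_markov_L2)
  let ?gap = "\<exists>\<theta>::real. -1 \<le> \<theta> \<and> \<theta> < 1 \<and> (\<forall>f\<in>L2 M. integral\<^sup>L M (\<lambda>x. (f x)\<^sup>2)
    \<le> 1 / (1 - \<theta>) * integral\<^sup>L M (\<lambda>x. f x * (f x - P f x)) + (integral\<^sup>L M f)\<^sup>2)"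
  have tau0: "0 \<le> tau_norm M (P ^^ k)" for k
    by (rule markov_L2.tau_norm_bounds(1)[OF E.funpow_markov_L2])
  have tail0: "0 \<le> tail_norm M (Phat ^^ k)" for k
    by (rule markov_L2.tail_norm_bounds(1)[OF H.funpow_markov_L2])
  \<comment> \<open>All equivalences come from one dichotomy: with a gap the three quantities are
    below 1, without it they are at least 1.\<close>
  have yes: "tau_norm M P < 1 \<and> (INF m\<in>{1::nat..}. tau_norm M (P ^^ (2 * m - 1))) < 1
      \<and> (INF m\<in>{1::nat..}. tail_norm M (Phat ^^ m)) < 1" if ?gap
  proof -
    obtain \<theta> where \<theta>: "-1 \<le> \<theta>" "\<theta> < 1" and gap: "\<And>f. f \<in> L2 M \<Longrightarrow> integral\<^sup>L M (\<lambda>x. (f x)\<^sup>2)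
      \<le> 1 / (1 - \<theta>) * integral\<^sup>L M (\<lambda>x. f x * (f x - P f x)) + (integral\<^sup>L M f)\<^sup>2"
      using \<open>?gap\<close> by blast
    have Poincare: "L2_inner M f f \<le> 1 / (1 - \<theta>) * E.form f + (expectation f)\<^sup>2" if "f \<in> L2 M" for f
      using gap[OF that] by (simp add: L2_inner_self E.form_eq_expectation[OF that])
    have tau: "tau_norm M P < 1"
      using \<theta> Poincare by (rule E.Poincare_imp_tau_norm_less_1)
    have tail: "tail_norm M Phat < 1"
    proof (rule H.Poincare_imp_tail_norm_less_1)
      show "1 / (1 - \<theta>) > 0" using \<theta> by simp
      show "L2_inner M g (Phat f) = L2_inner M (Phat g) f" if "f \<in> L2 M" "g \<in> L2 M" for f g
        unfolding Phat using that by (rule E.Phat_symmetric)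
      show "L2_inner M f f \<le> 1 / (1 - \<theta>) * H.form f + (expectation f)\<^sup>2" if "f \<in> L2 M" for f
        using Poincare[OF that] by (simp add: Phat E.form_Phat[OF that])
    qed
    \<comment> \<open>The index m = 1 already suffices in both infima; nonnegativity of the norms
      makes the infima genuine lower bounds.\<close>
    have "(INF m\<in>{1::nat..}. tau_norm M (P ^^ (2 * m - 1))) \<le> tau_norm M (P ^^ (2 * 1 - 1))"
      by (rule cINF_lower) (use tau0 in \<open>auto intro!: bdd_belowI[of _ 0]\<close>)
    moreover have "(INF m\<in>{1::nat..}. tail_norm M (Phat ^^ m)) \<le> tail_norm M (Phat ^^ 1)"
      by (rule cINF_lower) (use tail0 in \<open>auto intro!: bdd_belowI[of _ 0]\<close>)
    ultimately show ?thesis using tau tail by simp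
  qed
  have no: "1 \<le> tau_norm M P \<and> 1 \<le> (INF m\<in>{1::nat..}. tau_norm M (P ^^ (2 * m - 1)))
      \<and> 1 \<le> (INF m\<in>{1::nat..}. tail_norm M (Phat ^^ m))" if "\<not> ?gap"
  proof -
    have no_gap: "\<exists>f\<in>L2 M. \<eta> * (L2_inner M f f - (expectation f)\<^sup>2) > E.form f" if "\<eta> > 0" for \<eta>
    proof -
      \<comment> \<open>The largest admissible constant for a large \<eta> is 1 - \<theta> = 2,
        because \<theta> \<ge> -1; the variance turns out positive, so 1 - \<theta> may afterwards
        be replaced by \<eta>.\<close>
      define \<theta> where "\<theta> = max (-1) (1 - \<eta>)"
      have \<theta>: "-1 \<le> \<theta>" "\<theta> < 1" "1 - \<theta> \<le> \<eta>" using \<open>\<eta> > 0\<close> by (auto simp: \<theta>_def)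
      with \<open>\<not> ?gap\<close> obtain f where f: "f \<in> L2 M"
        and "\<not> integral\<^sup>L M (\<lambda>x. (f x)\<^sup>2)
          \<le> 1 / (1 - \<theta>) * integral\<^sup>L M (\<lambda>x. f x * (f x - P f x)) + (integral\<^sup>L M f)\<^sup>2" by blast
      then have "1 / (1 - \<theta>) * E.form f < L2_inner M f f - (expectation f)\<^sup>2" (is "_ < ?V")
        by (simp add: L2_inner_self E.form_eq_expectation[OF f])
      then have lt: "E.form f < (1 - \<theta>) * ?V" using \<theta> by (simp add: field_simps)
      then have "0 < (1 - \<theta>) * ?V" using E.form_nonneg[OF f] by linarith
      then have "?V > 0" using \<theta> by (simp add: zero_less_mult_iff)
      then have "(1 - \<theta>) * ?V \<le> \<eta> * ?V" using \<theta> by (intro mult_right_mono) auto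
      with lt f show ?thesis by (intro bexI[of _ f]) auto
    qed
    have conc: "\<exists>f\<in>L2 M. (\<forall>x. 0 \<le> f x) \<and> L2_inner M f f = 1 \<and> E.form f \<le> e \<and> expectation f \<le> e"
      if "e > 0" for e
    proof -
      obtain f where "f \<in> L2 M" "\<And>x. f x \<ge> 0" "L2_inner M f f = 1" "E.form f \<le> e" "expectation f \<le> e"
        using E.concentrating_unit_functions[OF no_gap \<open>e > 0\<close>] by blast
      then show ?thesis by blast
    qed
    have tau: "1 \<le> tau_norm M (P ^^ k)" for k
      using conc by (rule E.funpow_norms_ge_1(1))
    have "\<exists>f\<in>L2 M. (\<forall>x. 0 \<le> f x) \<and> L2_inner M f f = 1 \<and> H.form f \<le> e \<and> expectation f \<le> e"
      if "e > 0" for e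
    proof -
      obtain f where "f \<in> L2 M" "\<forall>x. 0 \<le> f x" "L2_inner M f f = 1" "E.form f \<le> e" "expectation f \<le> e"
        using conc[OF \<open>e > 0\<close>] by blast
      then show ?thesis unfolding Phat by (intro bexI[of _ f]) (simp_all add: E.form_Phat)
    qed
    then have tail: "1 \<le> tail_norm M (Phat ^^ k)" for k
      by (rule H.funpow_norms_ge_1(2))
    show ?thesis using tau[of 1] tau tail by (auto intro!: cINF_greatest)
  qed
  show ?thesis using yes no by (cases ?gap) (auto simp: not_less)
qed

end
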